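(* For all integers $t$ and $d$ with $1<d<t$, we have $s(H_{t,d})=d^2$.
   Context: All graphs are finite and simple. For graphs $F$ and $H$, write $F\to H$ ($F$ is Ramsey for $H$) if every coloring of the edges of $F$ with two colors (red and blue) contains a monochromatic copy of $H$ (a copy means a not necessarily induced subgraph isomorphic to $H$). $F$ is Ramsey $H$-minimal if $F\to H$ and no proper subgraph $F'$ of $F$ satisfies $F'\to H$; $\mathcal{M}(H)$ is the set of Ramsey $H$-minimal graphs. Define $s(H)=\min_{F\in\mathcal{M}(H)}\delta(F)$, where $\delta(F)$ is the minimum degree of $F$. For $0\le d\le t$, $H_{t,d}$ is the graph on $t+1$ vertices consisting of a complete graph $K_t$ together with one additional vertex adjacent to exactly $d$ vertices of the $K_t$. *)

theory Defs
  imports Complex_Main "HOL-Library.Ramsey"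
begin

datatype 'a graph = Graph (verts: "'a set") (edges: "'a set set")

definition simple_graph :: "'a graph \<Rightarrow> bool" where
  "simple_graph G \<longleftrightarrow> finite (verts G) \<and> edges G \<subseteq> [verts G]\<^bsup>2\<^esup>"

definition subgraph :: "'a graph \<Rightarrow> 'a graph \<Rightarrow> bool" where
  "subgraph G' G \<longleftrightarrow> simple_graph G' \<and> verts G' \<subseteq> verts G \<and> edges G' \<subseteq> edges G"

definition isomorphic :: "'a graph \<Rightarrow> 'b graph \<Rightarrow> bool" where
  "isomorphic G H \<longleftrightarrow>
     (\<exists>f. bij_betw f (verts G) (verts H) \<and>
          (\<forall>x\<in>verts G. \<forall>y\<in>verts G. {x, y} \<in> edges G \<longleftrightarrow> {f x, f y} \<in> edges H))"

definition degree :: "'a graph \<Rightarrow> 'a \<Rightarrow> nat" where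
  "degree G v = card {e \<in> edges G. v \<in> e}"

text \<open>Meaningful for finite graphs with at least one vertex.\<close>
definition min_degree :: "'a graph \<Rightarrow> nat" where
  "min_degree G = Min (degree G ` verts G)"

datatype colour = Red | Blue

text \<open>A colouring is a total function on sets of vertices; only its values on edges matter.\<close>
definition ramsey_for :: "'a graph \<Rightarrow> 'b graph \<Rightarrow> bool" where
  "ramsey_for F H \<longleftrightarrow>
     (\<forall>col :: 'a set \<Rightarrow> colour. \<exists>H' c.
        subgraph H' F \<and> isomorphic H' H \<and> (\<forall>e\<in>edges H'. col e = c))"

definition ramsey_minimal :: "'b graph \<Rightarrow> 'a graph set" where
  "ramsey_minimal H =
     {F. simple_graph F \<and> ramsey_for F H \<and>
         (\<forall>F'. subgraph F' F \<and> F' \<noteq> F \<longrightarrow> \<not> ramsey_for F' H)}"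

text \<open>Every finite graph is isomorphic to one on natural numbers, so it suffices to let
  \<open>F\<close> range over those. By Ramsey's theorem the minimum is taken over a nonempty set.\<close>
definition ramsey_min_degree :: "'b graph \<Rightarrow> nat" where
  "ramsey_min_degree H =
     (LEAST k. \<exists>F :: nat graph. F \<in> ramsey_minimal H \<and> min_degree F = k)"

text \<open>The vertices \<open>0, \<dots>, t - 1\<close> form the complete graph; \<open>t\<close> is the additional vertex,
  adjacent to \<open>0, \<dots>, d - 1\<close>. Intended for \<open>d \<le> t\<close>.\<close>
definition clique_plus_vertex :: "nat \<Rightarrow> nat \<Rightarrow> nat graph" where
  "clique_plus_vertex t d = Graph {..t} ([{..<t}]\<^bsup>2\<^esup> \<union> {{i, t} | i. i < d})"

end

theory Submission
  imports Defs "HOL-Library.FuncSet" "HOL-Library.Disjoint_Sets"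
begin

text \<open>Write \<open>H\<close> for the graph in question. In \<open>H\<close> every vertex lies in a \<open>K\<^bsub>d+1\<^esub>\<close>, so a vertex of degree
  less than \<open>d\<^sup>2\<close> can always be coloured after the rest, as for cliques; this gives the lower bound.

  For the upper bound it suffices to find a graph \<open>G\<close> with an \<open>H\<close>-free colouring such that every \<open>H\<close>-free
  colouring of \<open>G\<close> contains, up to swapping colours, a fixed coloured pattern on which any new vertex of degree
  \<open>d\<^sup>2\<close> completes a monochromatic \<open>H\<close>: adding such vertices to all \<open>d\<^sup>2\<close>-sets makes \<open>G\<close> Ramsey, and a
  minimal Ramsey subgraph must use one of them. The graph \<open>G\<close> comes from a partite construction in the style of
  Nesetril and Roedl, which makes colours depend only on vertex labels. Since \<open>H\<close> maps homomorphically to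
  \<open>K\<^sub>t\<close>, an \<open>H\<close>-free label colouring has to avoid prescribed monochromatic \<open>K\<^sub>t\<close>'s, and a minimality argument
  turns this into forced colours.\<close>

subsection \<open>A bipartite induced Ramsey theorem\<close>

text \<open>The number d^2 is d times d on both sides. Fewer than d^2 neighbours hold fewer than d
  disjoint red copies of K_d; and any two-colouring of the points of a d by d grid has a red row or
  a blue transversal. The obstacle in the upper bound is d = 2: the two neighbours of the apex then
  separate H, so gluing two graphs along an edge can create a copy of H. The partite construction
  guards against this by forbidding a monochromatic K_t over any label pair whose colours it
  controls. But the pattern itself has to contain monochromatic K_t's. It is therefore placed on
  clones, whose mutual label pairs stay uncontrolled, and its colours are forced indirectly through
  gadgets. These use again that d < t: the apex and the vertex t - 1 are nonadjacent, which keeps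
  monochromatic K_t's out of a gadget.\<close>

lemma UNIV_colour: "UNIV = {Red, Blue}"
  using colour.exhaust by auto

lemma finite_UNIV_colour [simp]: "finite (UNIV :: colour set)"
  by (simp add: UNIV_colour)

lemma colour_neq_trans: "x \<noteq> y \<Longrightarrow> z \<noteq> y \<Longrightarrow> x = (z :: colour)"
  by (cases x; cases y; cases z) auto

fun opposite :: "colour \<Rightarrow> colour" where
  "opposite Red = Blue"
| "opposite Blue = Red"

lemma opposite_neq [simp]: "opposite a \<noteq> a" "a \<noteq> opposite a"
  by (cases a; simp)+

lemma neq_opposite: "a \<noteq> b \<longleftrightarrow> a = opposite b"
  by (cases a; cases b) auto

lemma large_fibre:
  assumes "finite A" "f \<in> A \<rightarrow> B" "finite B" "m * card B < card A"
  obtains b where "m \<le> card {a \<in> A. f a = b}"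
proof -
  have "A \<noteq> {}"
    using assms(4) by auto
  then have "B \<noteq> {}"
    using assms(2) by auto
  then obtain b where "card A \<le> card (f -` {b} \<inter> A) * card B"
    using pigeonhole_card assms by blast
  then have "m * card B < card (f -` {b} \<inter> A) * card B"
    using assms(4) by linarith
  moreover have "f -` {b} \<inter> A = {a \<in> A. f a = b}"
    by auto
  ultimately show thesis
    using that[of b] by simp
qed

text \<open>Induction on the dimension: a value \<open>u\<close> of the last coordinate is coloured
  by the whole colouring that it induces on the other coordinates. The pigeonhole principle gives
  \<open>m\<close> values with the same induced colouring, and the induction hypothesis is applied
  to that one.\<close>

lemma product_ramsey:
  fixes K :: "'c set"
  assumes "finite K"
  shows "\<exists>M::nat. \<forall>F. F \<in> (PiE {..<k::nat} (\<lambda>_. {..<M})) \<rightarrow> K \<longrightarrow>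
    (\<exists>U a. (\<forall>p<k. U p \<subseteq> {..<M} \<and> card (U p) = m) \<and> (\<forall>g \<in> PiE {..<k} U. F g = a))"
proof (induction k)
  case 0
  show ?case
    by auto
next
  case (Suc k)
  then obtain M :: nat where M: "\<And>F. F \<in> (PiE {..<k} (\<lambda>_. {..<M})) \<rightarrow> K \<Longrightarrow>
    (\<exists>U a. (\<forall>p<k. U p \<subseteq> {..<M} \<and> card (U p) = m) \<and> (\<forall>g \<in> PiE {..<k} U. F g = a))"
    by blast
  define D where "D = PiE {..<k} (\<lambda>_. {..<M})"
  define FF where "FF = PiE D (\<lambda>_. K)"
  have finD: "finite D"
    unfolding D_def by (intro finite_PiE) auto
  have finFF: "finite FF"
    unfolding FF_def using finD assms by (intro finite_PiE) auto
  \<comment> \<open>The first argument leaves room for the smaller box, the second exceeds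
    \<open>m\<close> times the number of possible slice colourings.\<close>
  define M1 where "M1 = max M (Suc (m * card FF))"
  show ?case
  proof (intro exI[of _ M1] allI impI)
    fix F
    assume F: "F \<in> (PiE {..<Suc k} (\<lambda>_. {..<M1})) \<rightarrow> K"
    define G where "G = (\<lambda>u. \<lambda>g\<in>D. F (g(k := u)))"
    have MM1: "M \<le> M1"
      by (simp add: M1_def)
    have upd: "g(k := u) \<in> PiE {..<Suc k} (\<lambda>_. {..<M1})" if "g \<in> D" "u < M1" for g u
      using that MM1 unfolding D_def by (auto simp: PiE_iff less_Suc_eq extensional_def intro: less_le_trans)
    have G: "G \<in> {..<M1} \<rightarrow> FF"
      using F upd unfolding G_def FF_def by (auto simp: PiE_def Pi_def)
    have "m * card FF < card {..<M1}"
      by (simp add: M1_def)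
    then obtain b where b: "m \<le> card {u \<in> {..<M1}. G u = b}"
      using large_fibre[OF finite_lessThan G finFF] by blast
    obtain W where W: "W \<subseteq> {u \<in> {..<M1}. G u = b}" "card W = m"
      using obtain_subset_with_card_n[OF b] by blast
    show "\<exists>U a. (\<forall>p<Suc k. U p \<subseteq> {..<M1} \<and> card (U p) = m) \<and> (\<forall>g \<in> PiE {..<Suc k} U. F g = a)"
    proof (cases "W = {}")
      case True
      then have "m = 0"
        using W by simp
      then show ?thesis
        by (intro exI[of _ "\<lambda>_. {}"]) (auto simp: PiE_def Pi_def)
    next
      case False
      then obtain u0 where u0: "u0 \<in> W"
        by blast
      have "(\<lambda>g. F (g(k := u0))) \<in> PiE {..<k} (\<lambda>_. {..<M}) \<rightarrow> K"
      proof
        fix g assume "g \<in> PiE {..<k} (\<lambda>_. {..<M})"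
        then have "g(k := u0) \<in> PiE {..<Suc k} (\<lambda>_. {..<M1})"
          using upd u0 W by (auto simp: D_def)
        then show "F (g(k := u0)) \<in> K"
          using F by blast
      qed
      from M[OF this] obtain U a where
        U: "\<And>p. p < k \<Longrightarrow> U p \<subseteq> {..<M} \<and> card (U p) = m"
           "\<And>g. g \<in> PiE {..<k} U \<Longrightarrow> F (g(k := u0)) = a"
        by blast
      have "F g = a" if g: "g \<in> PiE {..<Suc k} (U(k := W))" for g
      proof -
        define g' where "g' = restrict g {..<k}"
        have g': "g' \<in> PiE {..<k} U"
          using g unfolding g'_def PiE_iff by (auto split: if_splits dest: less_SucI bspec)
        then have g'D: "g' \<in> D"
          using U(1) unfolding D_def by (fastforce simp: PiE_def Pi_def)
        have gk: "g k \<in> W"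
          using g by (auto simp: PiE_def Pi_def dest: bspec[of _ _ k])
        have "g = g'(k := g k)"
          using g unfolding g'_def by (auto simp: PiE_def extensional_def fun_eq_iff)
        then have "F g = G (g k) g'"
          unfolding G_def using g'D by (metis restrict_apply')
        also have "\<dots> = G u0 g'"
          using subsetD[OF W(1) gk] subsetD[OF W(1) u0] by simp
        also have "\<dots> = a"
          using g'D U(2)[OF g'] by (simp add: G_def)
        finally show ?thesis .
      qed
      moreover have "(U(k := W)) p \<subseteq> {..<M1} \<and> card ((U(k := W)) p) = m" if "p < Suc k" for p
      proof -
        have "{..<M} \<subseteq> {..<M1}"
          using MM1 by simp
        then have "U q \<subseteq> {..<M1} \<and> card (U q) = m" if "q < k" for q
          using U(1)[OF that] by (meson order_trans)
        moreover have "W \<subseteq> {..<M1}"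
          using W(1) by (rule subset_trans) auto
        ultimately show ?thesis
          using W(2) that by (cases "p = k") simp_all
      qed
      ultimately show ?thesis
        by (intro exI[of _ "U(k := W)"] exI[of _ a]) blast
    qed
  qed
qed

text \<open>The host is the incidence graph of the complete \<open>k\<close>-partite \<open>k\<close>-uniform hypergraph:
  \<open>(p, u)\<close> is adjacent to the transversal \<open>g\<close> iff \<open>g p = u\<close>.\<close>

lemma induced_bipartite_ramsey:
  fixes X :: "'x set" and Y :: "'y set"
  assumes "finite X" "finite Y"
  shows "\<exists>(X' :: (nat \<times> nat) set) (Y' :: (nat \<Rightarrow> nat) set) R'. finite X' \<and> finite Y' \<and>
    (\<forall>\<kappa> :: nat \<times> nat \<Rightarrow> (nat \<Rightarrow> nat) \<Rightarrow> colour. \<exists>f g a.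
      inj_on f X \<and> f ` X \<subseteq> X' \<and> inj_on g Y \<and> g ` Y \<subseteq> Y' \<and>
      (\<forall>x\<in>X. \<forall>y\<in>Y. R' (f x) (g y) \<longleftrightarrow> R x y) \<and>
      (\<forall>x\<in>X. \<forall>y\<in>Y. R x y \<longrightarrow> \<kappa> (f x) (g y) = a))"
proof -
  define n where "n = card X"
  \<comment> \<open>Among \<open>2 * n + 1\<close> coordinates some colour occurs at
    \<open>n\<close> of them; these host \<open>X\<close>, and a coordinate is left over for
    \<open>p0\<close>.\<close>
  define k where "k = 2 * n + 1"
  \<comment> \<open>In each coordinate one value encodes adjacency, and the other
    \<open>card Y\<close> values encode nonadjacency, one for each \<open>y\<close>.\<close>
  define m where "m = Suc (card Y)"
  have "finite (PiE {..<k} (\<lambda>_. UNIV :: colour set))"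
    by (intro finite_PiE) auto
  from product_ramsey[OF this, of k m] obtain M :: nat where
    M: "\<And>F. F \<in> (PiE {..<k} (\<lambda>_. {..<M})) \<rightarrow> (PiE {..<k} (\<lambda>_. UNIV :: colour set)) \<Longrightarrow>
    (\<exists>U a. (\<forall>p<k. U p \<subseteq> {..<M} \<and> card (U p) = m) \<and> (\<forall>g \<in> PiE {..<k} U. F g = a))"
    by blast
  let ?X = "{..<k} \<times> {..<M}" and ?Y = "PiE {..<k} (\<lambda>_. {..<M})"
  have "\<exists>f g a.
      inj_on f X \<and> f ` X \<subseteq> ?X \<and> inj_on g Y \<and> g ` Y \<subseteq> ?Y \<and>
      (\<forall>x\<in>X. \<forall>y\<in>Y. (g y (fst (f x)) = snd (f x)) \<longleftrightarrow> R x y) \<and>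
      (\<forall>x\<in>X. \<forall>y\<in>Y. R x y \<longrightarrow> \<kappa> (f x) (g y) = a)"
    for \<kappa> :: "nat \<times> nat \<Rightarrow> (nat \<Rightarrow> nat) \<Rightarrow> colour"
  proof -
    \<comment> \<open>A transversal is coloured by the vector of colours of its \<open>k\<close>
      edges; on the subbox the colour of an edge then depends on its coordinate alone.\<close>
    have "(\<lambda>g. \<lambda>p\<in>{..<k}. \<kappa> (p, g p) g) \<in> ?Y \<rightarrow> (PiE {..<k} (\<lambda>_. UNIV :: colour set))"
      by auto
    from M[OF this] obtain U v where
      U: "\<And>p. p < k \<Longrightarrow> U p \<subseteq> {..<M} \<and> card (U p) = m" and
      Uv: "\<And>g. g \<in> PiE {..<k} U \<Longrightarrow> (\<lambda>p\<in>{..<k}. \<kappa> (p, g p) g) = v"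
      by blast
    then have v: "\<kappa> (p, g p) g = v p" if "g \<in> PiE {..<k} U" "p < k" for g p
      using fun_cong[OF Uv[OF that(1)], of p] that(2) by simp
    have "v \<in> {..<k} \<rightarrow> UNIV" "n * card (UNIV :: colour set) < card {..<k}"
      by (simp, simp add: k_def UNIV_colour)
    then obtain a where a: "n \<le> card {p \<in> {..<k}. v p = a}"
      using large_fibre[OF finite_lessThan _ finite_UNIV_colour] by blast
    obtain P where P: "P \<subseteq> {p \<in> {..<k}. v p = a}" "card P = n" "finite P"
      using obtain_subset_with_card_n[OF a] by blast
    have "card X = card P"
      using P(2) n_def by simp
    then obtain e where e: "bij_betw e X P"
      using finite_same_card_bij[OF assms(1) P(3)] by blast
    have "\<not> {..<k} \<subseteq> P"
      using card_mono[OF P(3), of "{..<k}"] P(2) by (auto simp: k_def)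
    \<comment> \<open>No vertex of \<open>X\<close> is placed at \<open>p0\<close>, so
      \<open>g y\<close> always takes the value \<open>b p0 (i y)\<close> there. This makes
      \<open>g\<close> injective.\<close>
    then obtain p0 where p0: "p0 < k" "p0 \<notin> P"
      by blast
    have "\<exists>b. bij_betw b {..<m} (U p)" if "p < k" for p
      using U[OF that] finite_same_card_bij[of "{..<m}" "U p"] finite_subset by auto
    then obtain b where b: "\<And>p. p < k \<Longrightarrow> bij_betw (b p) {..<m} (U p)"
      by metis
    have "card Y = card {1..<m}"
      by (simp add: m_def)
    then obtain i where i: "bij_betw i Y {1..<m}"
      using finite_same_card_bij[OF assms(2) finite_atLeastLessThan] by blast
    have iY: "0 < i y" "i y < m" if "y \<in> Y" for y
      using bij_betwE[OF i] that by auto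
    have eX: "e x < k" "v (e x) = a" "e x \<in> P" if "x \<in> X" for x
      using bij_betwE[OF e] that P by auto
    have binj: "b p r = b p s \<longleftrightarrow> r = s" if "p < k" "r < m" "s < m" for p r s
      using b[OF that(1)] that by (auto simp: bij_betw_def inj_on_def)
    have bU: "b p r \<in> U p" if "p < k" "r < m" for p r
      using b[OF that(1)] that by (auto simp: bij_betw_def)
    define f where "f = (\<lambda>x. (e x, b (e x) 0))"
    define g where "g = (\<lambda>y. \<lambda>p\<in>{..<k}. if \<exists>x\<in>X. e x = p \<and> R x y then b p 0 else b p (i y))"
    have ge: "g y (e x) = (if R x y then b (e x) 0 else b (e x) (i y))" if "x \<in> X" for x y
      using that eX(1)[OF that] bij_betw_imp_inj_on[OF e] by (auto simp: g_def inj_on_def)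
    have gU: "g y \<in> PiE {..<k} U" if "y \<in> Y" for y
      using that iY bU by (auto simp: g_def m_def)
    have "inj_on f X"
      using bij_betw_imp_inj_on[OF e] by (auto simp: f_def inj_on_def)
    moreover have "f ` X \<subseteq> ?X"
    proof (rule image_subsetI)
      fix x assume x: "x \<in> X"
      have "b (e x) 0 \<in> U (e x)"
        using bU[OF eX(1)[OF x]] by (simp add: m_def)
      then show "f x \<in> ?X"
        using U[OF eX(1)[OF x]] eX(1)[OF x] by (auto simp: f_def)
    qed
    moreover have "inj_on g Y"
    proof (rule inj_onI)
      fix y z
      assume yz: "y \<in> Y" "z \<in> Y" "g y = g z"
      have "g y p0 = b p0 (i y)" for y
        using p0 eX by (auto simp: g_def)
      then have "i y = i z"
        using yz binj[OF p0(1)] iY by metis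
      then show "y = z"
        using i yz by (auto simp: bij_betw_def inj_on_def)
    qed
    moreover have "PiE {..<k} U \<subseteq> ?Y"
      using U by (intro PiE_mono) auto
    then have "g ` Y \<subseteq> ?Y"
      using gU by blast
    moreover have "(g y (fst (f x)) = snd (f x)) \<longleftrightarrow> R x y" if "x \<in> X" "y \<in> Y" for x y
      using ge[OF that(1)] binj[OF eX(1)[OF that(1)], of "i y" 0] iY[OF that(2)] by (auto simp: f_def)
    moreover have "\<kappa> (f x) (g y) = a" if "x \<in> X" "y \<in> Y" "R x y" for x y
      using v[OF gU[OF that(2)] eX(1)[OF that(1)]] ge[OF that(1), of y] that(3) eX(2)[OF that(1)]
      by (simp add: f_def)
    ultimately show ?thesis
      by (intro exI[of _ f] exI[of _ g] exI[of _ a]) blast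
  qed
  note main = this
  have "finite ?X" "finite ?Y"
    by (auto intro!: finite_PiE)
  then show ?thesis
    by (intro exI[of _ ?X] exI[of _ ?Y] exI[of _ "\<lambda>z g. g (fst z) = snd z"] conjI allI main)
qed

subsection \<open>Monochromatic copies and the lower bound\<close>

locale almost_clique =
  fixes t d :: nat
  assumes d_gt: "1 < d" and t_gt: "d < t"
begin

definition hadj :: "nat \<Rightarrow> nat \<Rightarrow> bool" where
  "hadj k l \<longleftrightarrow> k < l \<and> (l < t \<or> l = t \<and> k < d)"

text \<open>Injectivity has to be demanded here, because the apex \<open>t\<close> is not adjacent
  to \<open>d\<close>, ..., \<open>t - 1\<close> and could coincide with one of them. In
  \<open>Kcopy\<close> all pairs are edges, so distinctness is automatic once edges are
  2-sets.\<close>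

definition Hcopy :: "'a set set \<Rightarrow> ('a set \<Rightarrow> colour) \<Rightarrow> colour \<Rightarrow> (nat \<Rightarrow> 'a) \<Rightarrow> bool" where
  "Hcopy E c a m \<longleftrightarrow> inj_on m {..t} \<and> (\<forall>k l. hadj k l \<longrightarrow> {m k, m l} \<in> E \<and> c {m k, m l} = a)"

definition Kcopy :: "'a set set \<Rightarrow> ('a set \<Rightarrow> colour) \<Rightarrow> colour \<Rightarrow> (nat \<Rightarrow> 'a) \<Rightarrow> bool" where
  "Kcopy E c a m \<longleftrightarrow> (\<forall>k l. k < l \<longrightarrow> l < t \<longrightarrow> {m k, m l} \<in> E \<and> c {m k, m l} = a)"

lemma hadj_clique: "k < l \<Longrightarrow> l < t \<Longrightarrow> hadj k l"
  by (simp add: hadj_def)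

lemma hadj_apex: "k < d \<Longrightarrow> hadj k t"
  using t_gt by (simp add: hadj_def)

lemma hadj_less: "hadj k l \<Longrightarrow> k < l \<and> k < t \<and> l \<le> t"
  using t_gt by (auto simp: hadj_def)

lemma hadj_0: "0 < k \<Longrightarrow> k \<le> t \<Longrightarrow> hadj 0 k"
  using d_gt t_gt by (auto simp: hadj_def)

lemma Hcopy_edge: "Hcopy E c a m \<Longrightarrow> hadj k l \<Longrightarrow> {m k, m l} \<in> E \<and> c {m k, m l} = a"
  by (simp add: Hcopy_def)

lemma Hcopy_Kcopy: "Hcopy E c a m \<Longrightarrow> Kcopy E c a m"
  by (simp add: Hcopy_def Kcopy_def hadj_def)

lemma Kcopy_edge: "Kcopy E c a m \<Longrightarrow> k \<noteq> l \<Longrightarrow> k < t \<Longrightarrow> l < t \<Longrightarrow> {m k, m l} \<in> E \<and> c {m k, m l} = a"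
  unfolding Kcopy_def by (metis insert_commute nat_neq_iff)

lemma Hcopy_map:
  assumes "Hcopy E c a m" "inj_on g (m ` {..t})"
    and "\<And>k l. hadj k l \<Longrightarrow> {g (m k), g (m l)} \<in> E' \<and> c' {g (m k), g (m l)} = c {m k, m l}"
  shows "Hcopy E' c' a (g \<circ> m)"
  using assms unfolding Hcopy_def by (auto intro: comp_inj_on)

lemma HcopyI:
  "inj_on m {..t} \<Longrightarrow> (\<And>k l. hadj k l \<Longrightarrow> {m k, m l} \<in> E \<and> c {m k, m l} = a) \<Longrightarrow> Hcopy E c a m"
  by (simp add: Hcopy_def)

lemma Hcopy_mono: "Hcopy E c a m \<Longrightarrow> E \<subseteq> E' \<Longrightarrow> Hcopy E' c a m"
  by (auto simp: Hcopy_def)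

lemma Hcopy_vertex:
  assumes "Hcopy E c a m" "E \<subseteq> [V]\<^bsup>2\<^esup>" "k \<le> t"
  shows "m k \<in> V"
proof (cases "k = 0")
  case True
  then show ?thesis
    using Hcopy_edge[OF assms(1) hadj_0[of 1]] assms(2) t_gt d_gt by (auto dest: subsetD)
next
  case False
  then show ?thesis
    using Hcopy_edge[OF assms(1) hadj_0[of k]] assms(2,3) by (auto dest: subsetD)
qed

section \<open>The Ramsey property in terms of embeddings\<close>

lemma edges_clique_plus_vertex: "edges (clique_plus_vertex t d) = {{k, l} | k l. hadj k l}"
proof (intro equalityI subsetI)
  fix e
  assume "e \<in> edges (clique_plus_vertex t d)"
  then consider "e \<in> [{..<t}]\<^bsup>2\<^esup>" | i where "i < d" "e = {i, t}"
    by (auto simp: clique_plus_vertex_def)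
  then show "e \<in> {{k, l} | k l. hadj k l}"
  proof cases
    case 1
    then obtain x y where xy: "e = {x, y}" "x < t" "y < t" "x \<noteq> y"
      by (auto elim!: nsets2_E)
    then have "hadj x y \<or> hadj y x"
      using hadj_clique by (meson linorder_neqE_nat)
    then show ?thesis
      using xy(1) by (auto simp: insert_commute)
  next
    case 2
    then show ?thesis
      using hadj_apex by auto
  qed
next
  fix e
  assume "e \<in> {{k, l} | k l. hadj k l}"
  then show "e \<in> edges (clique_plus_vertex t d)"
    by (auto simp: clique_plus_vertex_def hadj_def)
qed

lemma verts_clique_plus_vertex: "verts (clique_plus_vertex t d) = {..t}"
  by (simp add: clique_plus_vertex_def)

lemma ramsey_for_iff:
  fixes F :: "'a graph"
  assumes "simple_graph F"
  shows "ramsey_for F (clique_plus_vertex t d) \<longleftrightarrow> (\<forall>c. \<exists>a m. Hcopy (edges F) c a m)"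
proof
  assume R: "ramsey_for F (clique_plus_vertex t d)"
  show "\<forall>c. \<exists>a m. Hcopy (edges F) c a m"
  proof
    fix c :: "'a set \<Rightarrow> colour"
    obtain H' a where H': "subgraph H' F" "isomorphic H' (clique_plus_vertex t d)"
        "\<forall>e\<in>edges H'. c e = a"
      using R unfolding ramsey_for_def by blast
    then obtain f where f: "bij_betw f (verts H') {..t}"
      "\<And>x y. x \<in> verts H' \<Longrightarrow> y \<in> verts H' \<Longrightarrow>
        {x, y} \<in> edges H' \<longleftrightarrow> {f x, f y} \<in> edges (clique_plus_vertex t d)"
      unfolding isomorphic_def verts_clique_plus_vertex by blast
    define m where "m = inv_into (verts H') f"
    have m: "m k \<in> verts H'" "f (m k) = k" if "k \<le> t" for k
      using that f(1) unfolding m_def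
      by (auto simp: bij_betw_def inv_into_into f_inv_into_f)
    have "inj_on m {..t}"
      by (metis m(2) inj_onI atMost_iff)
    moreover have "{m k, m l} \<in> edges F \<and> c {m k, m l} = a" if "hadj k l" for k l
    proof -
      have "k \<le> t" "l \<le> t"
        using hadj_less[OF that] by auto
      then have "{m k, m l} \<in> edges H'"
        using f(2)[of "m k" "m l"] m that by (auto simp: edges_clique_plus_vertex)
      then show ?thesis
        using H' by (auto simp: subgraph_def)
    qed
    ultimately show "\<exists>a m. Hcopy (edges F) c a m"
      unfolding Hcopy_def by blast
  qed
next
  assume R: "\<forall>c. \<exists>a m. Hcopy (edges F) c a m"
  show "ramsey_for F (clique_plus_vertex t d)"
    unfolding ramsey_for_def
  proof
    fix c :: "'a set \<Rightarrow> colour"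
    obtain a m where m: "Hcopy (edges F) c a m"
      using R by blast
    define H' where "H' = Graph (m ` {..t}) {{m k, m l} | k l. hadj k l}"
    have inj: "inj_on m {..t}"
      using m by (simp add: Hcopy_def)
    have pair: "{m k, m l} \<in> [m ` {..t}]\<^bsup>2\<^esup>" if "hadj k l" for k l
      using hadj_less[OF that] inj by (auto simp: inj_on_def)
    have vF: "m k \<in> verts F" if "k \<le> t" for k
    proof (cases "k = 0")
      case True
      then have "{m k, m 1} \<in> edges F"
        using Hcopy_edge[OF m hadj_0[of 1]] t_gt d_gt by auto
      then show ?thesis
        using assms by (auto simp: simple_graph_def dest: subsetD)
    next
      case False
      then have "{m 0, m k} \<in> edges F"
        using Hcopy_edge[OF m hadj_0[of k]] that by auto
      then show ?thesis
        using assms by (auto simp: simple_graph_def dest: subsetD)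
    qed
    have "subgraph H' F"
      using pair vF Hcopy_edge[OF m] unfolding subgraph_def simple_graph_def H'_def by auto
    moreover have "isomorphic H' (clique_plus_vertex t d)"
      unfolding isomorphic_def verts_clique_plus_vertex
    proof (intro exI conjI ballI)
      show "bij_betw (inv_into {..t} m) (verts H') {..t}"
        using inj by (simp add: H'_def bij_betw_inv_into inj_on_imp_bij_betw)
      fix x y
      assume "x \<in> verts H'" "y \<in> verts H'"
      then obtain k l where kl: "x = m k" "y = m l" "k \<le> t" "l \<le> t"
        by (auto simp: H'_def)
      have eq: "{m k, m l} = {m k', m l'} \<longleftrightarrow> {k, l} = {k', l'}" if "hadj k' l'" for k' l'
        using inj_on_eq_iff[OF inj] kl(3,4) hadj_less[OF that] by (simp add: doubleton_eq_iff)
      have "{m k, m l} \<in> {{m k, m l} | k l. hadj k l} \<longleftrightarrow> {k, l} \<in> {{k, l} | k l. hadj k l}"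
        unfolding mem_Collect_eq by (intro ex_cong1) (use eq in blast)
      then show "{x, y} \<in> edges H' \<longleftrightarrow>
          {inv_into {..t} m x, inv_into {..t} m y} \<in> edges (clique_plus_vertex t d)"
        using inj kl by (simp add: H'_def edges_clique_plus_vertex)
    qed
    moreover have "\<forall>e\<in>edges H'. c e = a"
      using Hcopy_edge[OF m] by (auto simp: H'_def)
    ultimately show "\<exists>H' a. subgraph H' F \<and> isomorphic H' (clique_plus_vertex t d) \<and> (\<forall>e\<in>edges H'. c e = a)"
      by (intro exI[of _ H'] exI[of _ a]) blast
  qed
qed

section \<open>The degree bound for Ramsey minimal graphs\<close>

lemma hadj_in_clique:
  assumes "k \<le> t"
  obtains B where "B \<subseteq> {..t}" "k \<notin> B" "card B = d"
    "\<And>i j. i \<in> insert k B \<Longrightarrow> j \<in> insert k B \<Longrightarrow> i \<noteq> j \<Longrightarrow> hadj i j \<or> hadj j i"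
proof (cases "k = t")
  case True
  show thesis
  proof (rule that[of "{..<d}"])
    fix i j
    assume "i \<in> insert k {..<d}" "j \<in> insert k {..<d}" "i \<noteq> j"
    then show "hadj i j \<or> hadj j i"
      using True t_gt by (cases i j rule: linorder_cases) (auto simp: hadj_def)
  qed (use True t_gt in auto)
next
  case False
  \<comment> \<open>Any \<open>d\<close> of the remaining \<open>t - 1\<close> clique vertices will
    do, as d < t.\<close>
  then have "d \<le> card ({..<t} - {k})"
    using assms t_gt by simp
  then obtain B where B: "B \<subseteq> {..<t} - {k}" "card B = d"
    using obtain_subset_with_card_n by metis
  show thesis
  proof (rule that[of B])
    fix i j
    assume "i \<in> insert k B" "j \<in> insert k B" "i \<noteq> j"
    moreover have "insert k B \<subseteq> {..<t}"
      using B assms False by auto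
    ultimately have "i < t" "j < t" "i \<noteq> j"
      by auto
    then show "hadj i j \<or> hadj j i"
      using hadj_clique by (meson linorder_neqE_nat)
  qed (use B in auto)
qed

text \<open>Extend an \<open>H\<close>-free colouring of \<open>F - v\<close> by colouring the edges from \<open>v\<close> to a maximal family of disjoint
  red \<open>K\<^sub>d\<close>'s in the neighbourhood of \<open>v\<close> blue and the other edges at \<open>v\<close> red. If there are fewer than \<open>d\<close>
  of these cliques, \<open>v\<close> lies in no monochromatic \<open>K\<^bsub>d+1\<^esub>\<close>, whereas every vertex of \<open>H\<close> does.\<close>

lemma degree_ramsey_minimal:
  fixes F :: "'a graph"
  assumes F: "F \<in> ramsey_minimal (clique_plus_vertex t d)" and v: "v \<in> verts F"
  shows "d\<^sup>2 \<le> degree F v"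
proof (rule ccontr)
  assume "\<not> d\<^sup>2 \<le> degree F v"
  then have small: "degree F v < d\<^sup>2"
    by simp
  let ?E = "edges F"
  define F' where "F' = Graph (verts F - {v}) {e \<in> ?E. v \<notin> e}"
  have sF: "simple_graph F" and RF: "ramsey_for F (clique_plus_vertex t d)"
    using F by (auto simp: ramsey_minimal_def)
  have fin: "finite (verts F)" and EF: "?E \<subseteq> [verts F]\<^bsup>2\<^esup>"
    using sF by (auto simp: simple_graph_def)
  have sub: "subgraph F' F"
    using sF by (auto simp: F'_def subgraph_def simple_graph_def nsets_def)
  moreover have "F' \<noteq> F"
    using v by (cases F) (auto simp: F'_def)
  ultimately have "\<not> ramsey_for F' (clique_plus_vertex t d)"
    using F by (auto simp: ramsey_minimal_def)
  then obtain c where c: "\<And>a m. \<not> Hcopy {e \<in> ?E. v \<notin> e} c a m"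
    using ramsey_for_iff[of F'] sub by (auto simp: subgraph_def F'_def)
  define N where "N = {u. {u, v} \<in> ?E}"
  have "N \<subseteq> verts F"
    using EF by (auto simp: N_def)
  then have finN: "finite N"
    using fin finite_subset by blast
  have "{e \<in> ?E. v \<in> e} = (\<lambda>u. {u, v}) ` N"
  proof (intro equalityI subsetI)
    fix e assume e: "e \<in> {e \<in> ?E. v \<in> e}"
    then obtain x y where "e = {x, y}"
      using EF by (auto elim!: nsets2_E)
    then show "e \<in> (\<lambda>u. {u, v}) ` N"
      using e by (auto simp: N_def insert_commute)
  qed (auto simp: N_def)
  moreover have "inj_on (\<lambda>u. {u, v}) N"
    by (auto simp: inj_on_def doubleton_eq_iff)
  ultimately have cardN: "card N < d\<^sup>2"
    using small by (simp add: degree_def card_image)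
  define mono where "mono a D \<longleftrightarrow> D \<subseteq> N \<and> card D = d \<and>
    (\<forall>x\<in>D. \<forall>y\<in>D. x \<noteq> y \<longrightarrow> {x, y} \<in> ?E \<and> c {x, y} = a)" for a D
  define fam where "fam M \<longleftrightarrow> (\<forall>D\<in>M. mono Red D) \<and> disjoint M" for M
  have fam_card: "finite M \<and> card M * d = card (\<Union>M) \<and> \<Union>M \<subseteq> N" if "fam M" for M
  proof -
    have MN: "M \<subseteq> Pow N"
      using that by (auto simp: fam_def mono_def)
    then have fM: "finite M"
      using finN by (meson finite_Pow_iff finite_subset)
    have "card (\<Union>M) = (\<Sum>D\<in>M. card D)"
      using that finN MN by (intro card_Union_disjoint) (auto simp: fam_def intro: finite_subset)
    also have "\<dots> = card M * d"
      using that by (simp add: fam_def mono_def)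
    finally show ?thesis
      using fM MN by auto
  qed
  \<comment> \<open>The members of \<open>M\<close> are disjoint and use \<open>card M * d\<close>
    vertices of \<open>N\<close>, which has fewer than \<open>d * d\<close>.\<close>
  have fam_small: "card M < d" if "fam M" for M
  proof -
    have "card M * d \<le> card N"
      using fam_card[OF that] finN by (metis card_mono)
    then have "card M * d < d * d"
      using cardN le_less_trans unfolding power2_eq_square by blast
    then show ?thesis
      by simp
  qed
  have "fam {}"
    by (simp add: fam_def)
  then obtain M where M: "fam M" and Mmax: "\<And>M'. fam M' \<Longrightarrow> card M' \<le> card M"
    using ex_has_greatest_nat[of fam "{}" card d] fam_small by (metis less_imp_le)
  define W where "W = \<Union>M"
  define c' where "c' e = (if v \<in> e then if \<exists>u\<in>W. e = {u, v} then Blue else Red else c e)" for e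
  obtain a m where m: "Hcopy ?E c' a m"
    using ramsey_for_iff[OF sF] RF by blast
  have inj: "inj_on m {..t}"
    using m by (simp add: Hcopy_def)
  have "v \<in> m ` {..t}"
  proof (rule ccontr)
    assume "v \<notin> m ` {..t}"
    then have "v \<noteq> m k" if "k \<le> t" for k
      using that by auto
    then have "v \<notin> {m k, m l}" if "hadj k l" for k l
      using hadj_less[OF that] by simp
    then have "Hcopy {e \<in> ?E. v \<notin> e} c a m"
      using m by (simp add: Hcopy_def c'_def)
    then show False
      using c by blast
  qed
  then obtain k where k: "k \<le> t" "v = m k"
    by auto
  obtain B where B: "B \<subseteq> {..t}" "k \<notin> B" "card B = d"
    "\<And>i j. i \<in> insert k B \<Longrightarrow> j \<in> insert k B \<Longrightarrow> i \<noteq> j \<Longrightarrow> hadj i j \<or> hadj j i"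
    using hadj_in_clique[OF k(1)] by metis
  have edge: "{m i, m j} \<in> ?E \<and> c' {m i, m j} = a" if "i \<in> insert k B" "j \<in> insert k B" "i \<noteq> j" for i j
    using B(4)[OF that] Hcopy_edge[OF m] by (metis insert_commute)
  define D where "D = m ` B"
  have vD: "v \<notin> D"
    using inj B k by (auto simp: D_def inj_on_def)
  have cardD: "card D = d"
    using B inj unfolding D_def by (metis card_image inj_on_subset)
  have DN: "D \<subseteq> N" and Dv: "\<And>u. u \<in> D \<Longrightarrow> c' {u, v} = a"
    using edge[of _ k] k B(2) by (auto simp: D_def N_def)
  have DD: "{x, y} \<in> ?E \<and> c {x, y} = a" if "x \<in> D" "y \<in> D" "x \<noteq> y" for x y
  proof -
    from that obtain i j where "i \<in> B" "j \<in> B" "x = m i" "y = m j"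
      by (auto simp: D_def)
    then have "{x, y} \<in> ?E \<and> c' {x, y} = a"
      using edge that by blast
    then show ?thesis
      using that vD by (auto simp: c'_def split: if_splits)
  qed
  have c'v: "c' {u, v} = (if u \<in> W then Blue else Red)" for u
    by (auto simp: c'_def doubleton_eq_iff)
  show False
  proof (cases a)
    case Red
    \<comment> \<open>A red clique \<open>D\<close> joined to \<open>v\<close> in red avoids
      \<open>W\<close>, so it would enlarge the maximal family.\<close>
    then have "D \<inter> W = {}"
      using Dv unfolding c'v by (metis colour.distinct(1) disjoint_iff)
    moreover have "D \<noteq> {}"
      using cardD d_gt by auto
    ultimately have "D \<notin> M"
      by (auto simp: W_def)
    have "disjnt D Z \<and> disjnt Z D" if "Z \<in> M" for Z
      using \<open>D \<inter> W = {}\<close> that by (auto simp: W_def disjnt_def)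
    then have "disjoint (insert D M)"
      using M by (auto simp: fam_def pairwise_insert)
    moreover have "mono Red D"
      using DN DD cardD Red by (auto simp: mono_def)
    ultimately have "fam (insert D M)"
      using M by (auto simp: fam_def)
    from Mmax[OF this] show False
      using \<open>D \<notin> M\<close> fam_card[OF M] by simp
  next
    case Blue
    then have "D \<subseteq> W"
      using Dv unfolding c'v by (metis colour.distinct(1) subsetI)
    then have "\<forall>x\<in>D. \<exists>Z. Z \<in> M \<and> x \<in> Z"
      by (auto simp: W_def)
    then obtain z where z: "\<And>x. x \<in> D \<Longrightarrow> z x \<in> M \<and> x \<in> z x"
      by metis
    \<comment> \<open>Members of \<open>M\<close> are red and \<open>D\<close> is blue, so each
      member holds at most one vertex of \<open>D\<close>, and there are fewer than \<open>d\<close>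
      members.\<close>
    have "inj_on z D"
    proof (rule inj_onI, rule ccontr)
      fix x y
      assume xy: "x \<in> D" "y \<in> D" "z x = z y" "x \<noteq> y"
      then have "c {x, y} = Red"
        using z[of x] z[of y] M by (auto simp: fam_def mono_def)
      then show False
        using DD xy Blue by auto
    qed
    then have "card D \<le> card M"
      using z fam_card[OF M] by (intro card_inj_on_le) auto
    then show False
      using fam_small[OF M] cardD by simp
  qed
qed

end

subsection \<open>The partite construction\<close>

text \<open>Vertices of an amalgam: the two classes of the host, shared by all copies, and for each
  copy its own version of every remaining vertex.\<close>

datatype ('a, 'b, 'i, 'v) glued = LeftPart 'a | RightPart 'b | Private 'i 'v

context almost_clique
begin

text \<open>\<open>\<pi>\<close> labels the vertices, and over the label pairs in \<open>C\<close> the colour of an edge depends only on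
  its labels. The last clause is needed for \<open>d = 2\<close>: when two graphs are glued along an edge \<open>xy\<close> over
  \<open>C\<close>, a monochromatic \<open>K\<^sub>t\<close> through \<open>xy\<close> in one and a triangle on \<open>xy\<close> in the other would form
  a copy of \<open>H\<close>.\<close>

definition admissible ::
  "nat set set \<Rightarrow> (nat set \<Rightarrow> colour) \<Rightarrow> 'v set \<Rightarrow> 'v set set \<Rightarrow> ('v \<Rightarrow> nat) \<Rightarrow> ('v set \<Rightarrow> colour) \<Rightarrow> bool" where
  "admissible C \<chi> V E \<pi> c \<longleftrightarrow> finite V \<and> E \<subseteq> [V]\<^bsup>2\<^esup> \<and>
     (\<forall>x y. {x, y} \<in> E \<longrightarrow> \<pi> x \<noteq> \<pi> y) \<and>
     (\<forall>e\<in>E. \<pi> ` e \<in> C \<longrightarrow> c e = \<chi> (\<pi> ` e)) \<and>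
     (\<forall>a m. \<not> Hcopy E c a m) \<and>
     (\<forall>a m k l. Kcopy E c a m \<longrightarrow> k < l \<longrightarrow> l < t \<longrightarrow> {\<pi> (m k), \<pi> (m l)} \<notin> C)"

text \<open>The Ramsey property built up one label pair at a time, \<open>C\<close> being the pairs
  treated so far. The label colouring \<open>\<chi>\<close> depends on \<open>c\<close>, which is
  arbitrary and may contain monochromatic copies of H.\<close>

definition forcing ::
  "nat set set \<Rightarrow> 'u set \<Rightarrow> 'u set set \<Rightarrow> ('u \<Rightarrow> nat) \<Rightarrow> 'v set \<Rightarrow> 'v set set \<Rightarrow> ('v \<Rightarrow> nat) \<Rightarrow> bool" where
  "forcing C V\<^sub>0 E\<^sub>0 \<pi>\<^sub>0 V E \<pi> \<longleftrightarrow> (\<forall>c. \<exists>\<phi> \<chi>. inj_on \<phi> V\<^sub>0 \<and> \<phi> ` V\<^sub>0 \<subseteq> V \<and>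
     (\<forall>v\<in>V\<^sub>0. \<pi> (\<phi> v) = \<pi>\<^sub>0 v) \<and>
     (\<forall>e\<in>E\<^sub>0. \<phi> ` e \<in> E \<and> (\<pi>\<^sub>0 ` e \<in> C \<longrightarrow> c (\<phi> ` e) = (\<chi> (\<pi>\<^sub>0 ` e) :: colour))))"

text \<open>Each amalgamation enlarges the vertex type, while the induction over label pairs needs a
  single type. Relabelling the finite vertex set along an injection leads back to
  \<open>nat\<close>.\<close>

lemma admissible_transfer:
  fixes V :: "'v set" and h :: "'v \<Rightarrow> 'w"
  assumes adm: "admissible C \<chi> V E \<pi> c" and forc: "forcing C' V\<^sub>0 E\<^sub>0 \<pi>\<^sub>0 V E \<pi>"
    and E\<^sub>0: "E\<^sub>0 \<subseteq> [V\<^sub>0]\<^bsup>2\<^esup>" and h: "inj_on h V"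
  shows "\<exists>(V' :: 'w set) E' \<pi>' c'. admissible C \<chi> V' E' \<pi>' c' \<and> forcing C' V\<^sub>0 E\<^sub>0 \<pi>\<^sub>0 V' E' \<pi>'"
proof -
  define g where "g = inv_into V h"
  define V' where "V' = h ` V"
  define E' where "E' = (`) h ` E"
  have EV: "E \<subseteq> [V]\<^bsup>2\<^esup>"
    and noK: "\<And>a m k l. Kcopy E c a m \<Longrightarrow> k < l \<Longrightarrow> l < t \<Longrightarrow> {\<pi> (m k), \<pi> (m l)} \<notin> C"
    using adm by (auto simp: admissible_def)
  have gh: "g (h x) = x" if "x \<in> V" for x
    using h that by (simp add: g_def)
  have img: "g ` h ` e = e" if "e \<in> E" for e
  proof -
    have "e \<subseteq> V"
      using EV that by (auto simp: nsets_def)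
    then have "g ` h ` e = id ` e"
      unfolding image_image using gh by (intro image_cong) auto
    then show ?thesis
      by simp
  qed
  have down: "g ` e \<in> E" if "e \<in> E'" for e
    using that img by (auto simp: E'_def)
  then have down2: "{g x, g y} \<in> E" if "{x, y} \<in> E'" for x y
    using that by force
  have E'V': "E' \<subseteq> [V']\<^bsup>2\<^esup>"
  proof
    fix e assume "e \<in> E'"
    then obtain x y where "e = {h x, h y}" "{x, y} \<in> E"
      using EV by (auto simp: E'_def elim!: nsets2_E)
    moreover from this have "x \<in> V" "y \<in> V" "x \<noteq> y"
      using EV adm by (auto dest: subsetD simp: admissible_def)
    ultimately show "e \<in> [V']\<^bsup>2\<^esup>"
      using h by (auto simp: V'_def inj_on_def)
  qed
  have K: "Kcopy E c a (g \<circ> m)" if "Kcopy E' (\<lambda>e. c (g ` e)) a m" for a m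
    using that down2 unfolding Kcopy_def by auto
  have H: "Hcopy E c a (g \<circ> m)" if m: "Hcopy E' (\<lambda>e. c (g ` e)) a m" for a m
  proof (rule Hcopy_map[OF m])
    have "m ` {..t} \<subseteq> V'"
      using Hcopy_vertex[OF m E'V'] by auto
    moreover have "inj_on g V'"
      unfolding g_def V'_def by (intro inj_on_inv_into) simp
    ultimately show "inj_on g (m ` {..t})"
      using inj_on_subset by blast
  qed (use Hcopy_edge[OF m] down2 in auto)
  have "admissible C \<chi> V' E' (\<pi> \<circ> g) (\<lambda>e. c (g ` e))"
    unfolding admissible_def
  proof (intro conjI allI impI ballI)
    show "finite V'"
      using adm by (simp add: V'_def admissible_def)
    show "E' \<subseteq> [V']\<^bsup>2\<^esup>"
      by (rule E'V')
    show "(\<pi> \<circ> g) x \<noteq> (\<pi> \<circ> g) y" if "{x, y} \<in> E'" for x y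
      using down2[OF that] adm by (simp add: admissible_def)
    show "c (g ` e) = \<chi> ((\<pi> \<circ> g) ` e)" if "e \<in> E'" "(\<pi> \<circ> g) ` e \<in> C" for e
      using down[OF that(1)] adm that(2) by (simp add: admissible_def image_comp)
    show "\<not> Hcopy E' (\<lambda>e. c (g ` e)) a m" for a m
      using H adm by (auto simp: admissible_def)
    show "{(\<pi> \<circ> g) (m k), (\<pi> \<circ> g) (m l)} \<notin> C"
      if "Kcopy E' (\<lambda>e. c (g ` e)) a m" "k < l" "l < t" for a m k l
      using noK[OF K[OF that(1)] that(2,3)] by simp
  qed
  moreover have "forcing C' V\<^sub>0 E\<^sub>0 \<pi>\<^sub>0 V' E' (\<pi> \<circ> g)"
    unfolding forcing_def
  proof
    fix k :: "'w set \<Rightarrow> colour"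
    obtain \<phi> \<rho> where \<phi>: "inj_on \<phi> V\<^sub>0" "\<phi> ` V\<^sub>0 \<subseteq> V" "\<forall>v\<in>V\<^sub>0. \<pi> (\<phi> v) = \<pi>\<^sub>0 v"
      "\<forall>e\<in>E\<^sub>0. \<phi> ` e \<in> E \<and> (\<pi>\<^sub>0 ` e \<in> C' \<longrightarrow> k (h ` \<phi> ` e) = \<rho> (\<pi>\<^sub>0 ` e))"
      using forc[unfolded forcing_def, THEN spec, of "\<lambda>e. k (h ` e)"] by blast
    show "\<exists>\<phi> \<rho>. inj_on \<phi> V\<^sub>0 \<and> \<phi> ` V\<^sub>0 \<subseteq> V' \<and>
       (\<forall>v\<in>V\<^sub>0. (\<pi> \<circ> g) (\<phi> v) = \<pi>\<^sub>0 v) \<and>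
       (\<forall>e\<in>E\<^sub>0. \<phi> ` e \<in> E' \<and> (\<pi>\<^sub>0 ` e \<in> C' \<longrightarrow> k (\<phi> ` e) = \<rho> (\<pi>\<^sub>0 ` e)))"
    proof (intro exI[of _ "h \<circ> \<phi>"] exI[of _ \<rho>] conjI)
      show "inj_on (h \<circ> \<phi>) V\<^sub>0"
        using \<phi>(1,2) h by (meson comp_inj_on inj_on_subset)
      show "(h \<circ> \<phi>) ` V\<^sub>0 \<subseteq> V'"
        using \<phi>(2) by (auto simp: V'_def)
      show "\<forall>v\<in>V\<^sub>0. (\<pi> \<circ> g) ((h \<circ> \<phi>) v) = \<pi>\<^sub>0 v"
        using \<phi>(2,3) gh by auto
      show "\<forall>e\<in>E\<^sub>0. (h \<circ> \<phi>) ` e \<in> E' \<and> (\<pi>\<^sub>0 ` e \<in> C' \<longrightarrow> k ((h \<circ> \<phi>) ` e) = \<rho> (\<pi>\<^sub>0 ` e))"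
        unfolding image_comp[symmetric] E'_def using \<phi>(4) by blast
    qed
  qed
  ultimately show ?thesis
    by blast
qed

text \<open>The partite construction: the bipartite graph between the vertices labelled \<open>i\<close> and \<open>j\<close> is
  replaced by a Ramsey host, and each of its induced copies in the host is completed by fresh vertices
  to a copy of the whole graph.\<close>

lemma amalgamation_step:
  fixes V :: "nat set" and V\<^sub>0 :: "'u set"
  assumes adm: "admissible C \<chi> V E \<pi> c" and forc: "forcing C' V\<^sub>0 E\<^sub>0 \<pi>\<^sub>0 V E \<pi>"
    and E\<^sub>0: "E\<^sub>0 \<subseteq> [V\<^sub>0]\<^bsup>2\<^esup>" and ij: "{i, j} \<in> C" "i \<noteq> j"
  shows "\<exists>(V' :: nat set) E' \<pi>' c'. admissible C \<chi> V' E' \<pi>' c' \<and>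
    forcing (insert {i, j} C') V\<^sub>0 E\<^sub>0 \<pi>\<^sub>0 V' E' \<pi>'"
proof -
  have finV: "finite V" and EV: "E \<subseteq> [V]\<^bsup>2\<^esup>"
    and proper: "\<And>x y. {x, y} \<in> E \<Longrightarrow> \<pi> x \<noteq> \<pi> y"
    and canon: "\<And>e. e \<in> E \<Longrightarrow> \<pi> ` e \<in> C \<Longrightarrow> c e = \<chi> (\<pi> ` e)"
    and noH: "\<And>a m. \<not> Hcopy E c a m"
    and noK: "\<And>a m k l. Kcopy E c a m \<Longrightarrow> k < l \<Longrightarrow> l < t \<Longrightarrow> {\<pi> (m k), \<pi> (m l)} \<notin> C"
    using adm by (auto simp: admissible_def)
  have EVD: "x \<in> V" "y \<in> V" if "{x, y} \<in> E" for x y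
    using EV that by (auto dest: subsetD)
  define X where "X = {v \<in> V. \<pi> v = i}"
  define Y where "Y = {v \<in> V. \<pi> v = j}"
  have "finite X" "finite Y"
    using finV by (auto simp: X_def Y_def)
  from induced_bipartite_ramsey[OF this, of "\<lambda>x y. {x, y} \<in> E"]
  obtain X' :: "(nat \<times> nat) set" and Y' :: "(nat \<Rightarrow> nat) set" and R' where
    fin': "finite X'" "finite Y'" and ramsey:
    "\<And>\<kappa> :: nat \<times> nat \<Rightarrow> (nat \<Rightarrow> nat) \<Rightarrow> colour. \<exists>f g a.
      inj_on f X \<and> f ` X \<subseteq> X' \<and> inj_on g Y \<and> g ` Y \<subseteq> Y' \<and>
      (\<forall>x\<in>X. \<forall>y\<in>Y. R' (f x) (g y) \<longleftrightarrow> {x, y} \<in> E) \<and>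
      (\<forall>x\<in>X. \<forall>y\<in>Y. {x, y} \<in> E \<longrightarrow> \<kappa> (f x) (g y) = a)"
    by metis
  \<comment> \<open>All induced copies in the host are completed, since the monochromatic one is
    known only after the colouring is given. Extensional functions keep this index set
    finite.\<close>
  define \<Phi> where "\<Phi> = {(f, g). f \<in> PiE X (\<lambda>_. X') \<and> g \<in> PiE Y (\<lambda>_. Y') \<and> inj_on f X \<and> inj_on g Y \<and>
      (\<forall>x\<in>X. \<forall>y\<in>Y. R' (f x) (g y) \<longleftrightarrow> {x, y} \<in> E)}"
  have fin\<Phi>: "finite \<Phi>"
  proof (rule finite_subset)
    show "\<Phi> \<subseteq> PiE X (\<lambda>_. X') \<times> PiE Y (\<lambda>_. Y')"
      by (auto simp: \<Phi>_def)
    show "finite (PiE X (\<lambda>_. X') \<times> PiE Y (\<lambda>_. Y'))"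
      using \<open>finite X\<close> \<open>finite Y\<close> fin' by (intro finite_cartesian_product finite_PiE) auto
  qed
  define \<iota> where "\<iota> \<phi> v = (if v \<in> X then LeftPart (fst \<phi> v) else if v \<in> Y then RightPart (snd \<phi> v)
      else Private \<phi> v)" for \<phi> :: "(nat \<Rightarrow> nat \<times> nat) \<times> (nat \<Rightarrow> nat \<Rightarrow> nat)" and v
  define V' where "V' = (\<Union>\<phi>\<in>\<Phi>. \<iota> \<phi> ` V)"
  define E' where "E' = (\<Union>\<phi>\<in>\<Phi>. (`) (\<iota> \<phi>) ` E)"
  define \<pi>' where "\<pi>' w = (case w of LeftPart _ \<Rightarrow> i | RightPart _ \<Rightarrow> j | Private _ v \<Rightarrow> \<pi> v)"
    for w :: "(nat \<times> nat, nat \<Rightarrow> nat, (nat \<Rightarrow> nat \<times> nat) \<times> (nat \<Rightarrow> nat \<Rightarrow> nat), nat) glued"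
  \<comment> \<open>An edge may lie in several copies; the fact \<open>colour\<close> below shows
    that the choice is immaterial.\<close>
  define c' where "c' e = c (SOME e\<^sub>0. e\<^sub>0 \<in> E \<and> (\<exists>\<phi>\<in>\<Phi>. e = \<iota> \<phi> ` e\<^sub>0))" for e
  have XY: "X \<inter> Y = {}"
    using ij(2) by (auto simp: X_def Y_def)
  have \<pi>\<iota>: "\<pi>' (\<iota> \<phi> v) = \<pi> v" for \<phi> v
    by (auto simp: \<pi>'_def \<iota>_def X_def Y_def)
  have \<pi>'img: "\<pi>' ` \<iota> \<phi> ` e = \<pi> ` e" for \<phi> e
    by (simp add: image_image \<pi>\<iota>)
  have \<Phi>R: "R' (fst \<phi> x) (snd \<phi> y) \<longleftrightarrow> {x, y} \<in> E" if "\<phi> \<in> \<Phi>" "x \<in> X" "y \<in> Y" for \<phi> x y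
    using that by (auto simp: \<Phi>_def)
  have \<iota>inj: "inj_on (\<iota> \<phi>) V" if "\<phi> \<in> \<Phi>" for \<phi>
  proof (rule inj_onI)
    fix x y assume "x \<in> V" "y \<in> V" "\<iota> \<phi> x = \<iota> \<phi> y"
    moreover have "inj_on (fst \<phi>) X" "inj_on (snd \<phi>) Y"
      using that by (auto simp: \<Phi>_def)
    ultimately show "x = y"
      by (auto simp: \<iota>_def inj_on_def split: if_splits)
  qed
  have \<iota>eq: "x = y" if "\<phi> \<in> \<Phi>" "x \<in> V" "y \<in> V" "\<iota> \<phi> x = \<iota> \<phi> y" for \<phi> x y
    using inj_onD[OF \<iota>inj[OF that(1)] that(4) that(2,3)] .
  have priv: "\<iota> \<phi> v = Private \<phi> v" if "\<pi> v \<notin> {i, j}" for \<phi> v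
    using that by (auto simp: \<iota>_def X_def Y_def)
  have edgeE: "\<exists>\<phi>\<in>\<Phi>. \<exists>x y. {x, y} \<in> E \<and> p = \<iota> \<phi> x \<and> q = \<iota> \<phi> y" if pq: "{p, q} \<in> E'" for p q
  proof -
    from pq obtain \<phi> e where e: "\<phi> \<in> \<Phi>" "e \<in> E" "{p, q} = \<iota> \<phi> ` e"
      by (auto simp: E'_def)
    then obtain x y where "e = {x, y}"
      using EV by (auto elim!: nsets2_E)
    then have "p = \<iota> \<phi> x \<and> q = \<iota> \<phi> y \<or> p = \<iota> \<phi> y \<and> q = \<iota> \<phi> x" "{x, y} \<in> E" "{y, x} \<in> E"
      using e by (auto simp: doubleton_eq_iff insert_commute)
    then show ?thesis
      using e(1) by blast
  qed
  have proper': "\<pi>' p \<noteq> \<pi>' q" if "{p, q} \<in> E'" for p q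
    using edgeE[OF that] proper \<pi>\<iota> by auto
  \<comment> \<open>This is what confines cliques to one copy: a private vertex fixes the copy that
    holds all its neighbours.\<close>
  have adj: "\<phi> \<in> \<Phi> \<and> v \<in> V \<and> (\<exists>y\<in>V. q = \<iota> \<phi> y \<and> {v, y} \<in> E)" if pv: "{Private \<phi> v, q} \<in> E'" for \<phi> v q
  proof -
    obtain \<psi> x y where xy: "\<psi> \<in> \<Phi>" "{x, y} \<in> E" "Private \<phi> v = \<iota> \<psi> x" "q = \<iota> \<psi> y"
      using edgeE[OF pv] by blast
    then have "\<psi> = \<phi>" "x = v"
      by (auto simp: \<iota>_def split: if_splits)
    then show ?thesis
      using xy EVD by blast
  qed
  \<comment> \<open>An edge between host vertices may stem from another copy \<open>\<psi>\<close>,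
    but \<open>R'\<close> reflects adjacency in every copy. This is why an induced bipartite theorem
    is used.\<close>
  have induced: "{x, y} \<in> E" if \<phi>: "\<phi> \<in> \<Phi>" and xy: "x \<in> V" "y \<in> V" and e: "{\<iota> \<phi> x, \<iota> \<phi> y} \<in> E'" for \<phi> x y
  proof -
    have "\<pi> x \<noteq> \<pi> y"
      using proper'[OF e] by (simp add: \<pi>\<iota>)
    then consider "\<pi> x \<notin> {i, j}" | "\<pi> y \<notin> {i, j}" | "\<pi> x = i" "\<pi> y = j" | "\<pi> x = j" "\<pi> y = i"
      by (cases "\<pi> x = i"; cases "\<pi> x = j"; cases "\<pi> y = i"; cases "\<pi> y = j") auto
    then show ?thesis
    proof cases
      case 1
      then show ?thesis
        using adj[of \<phi> x "\<iota> \<phi> y"] e \<iota>eq[OF \<phi> xy(2)] by (auto simp: priv[OF 1])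
    next
      case 2
      then show ?thesis
        using adj[of \<phi> y "\<iota> \<phi> x"] e \<iota>eq[OF \<phi> xy(1)] by (auto simp: priv[OF 2] insert_commute)
    next
      case 3
      obtain \<psi> p q where pq: "\<psi> \<in> \<Phi>" "{p, q} \<in> E" "\<iota> \<phi> x = \<iota> \<psi> p" "\<iota> \<phi> y = \<iota> \<psi> q"
        using edgeE[OF e] by blast
      have lab: "\<pi> p = \<pi> x" "\<pi> q = \<pi> y"
        using \<pi>\<iota>[of \<phi>] \<pi>\<iota>[of \<psi>] pq(3,4) by metis+
      have "x \<in> X" "y \<in> Y" "p \<in> X" "q \<in> Y"
        using 3 xy EVD[OF pq(2)] lab by (auto simp: X_def Y_def)
      moreover from this have "fst \<phi> x = fst \<psi> p" "snd \<phi> y = snd \<psi> q"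
        using pq(3,4) XY by (auto simp: \<iota>_def split: if_splits)
      ultimately show ?thesis
        using \<Phi>R[OF pq(1), of p q] \<Phi>R[OF \<phi>, of x y] pq(2) by simp
    next
      case 4
      obtain \<psi> p q where pq: "\<psi> \<in> \<Phi>" "{p, q} \<in> E" "\<iota> \<phi> x = \<iota> \<psi> p" "\<iota> \<phi> y = \<iota> \<psi> q"
        using edgeE[OF e] by blast
      have lab: "\<pi> p = \<pi> x" "\<pi> q = \<pi> y"
        using \<pi>\<iota>[of \<phi>] \<pi>\<iota>[of \<psi>] pq(3,4) by metis+
      have "y \<in> X" "x \<in> Y" "q \<in> X" "p \<in> Y"
        using 4 xy EVD[OF pq(2)] lab by (auto simp: X_def Y_def)
      moreover from this have "fst \<phi> y = fst \<psi> q" "snd \<phi> x = snd \<psi> p"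
        using pq(3,4) XY by (auto simp: \<iota>_def split: if_splits)
      ultimately show ?thesis
        using \<Phi>R[OF pq(1), of q p] \<Phi>R[OF \<phi>, of y x] pq(2) by (simp add: insert_commute)
    qed
  qed
  have colour: "c' (\<iota> \<phi> ` e) = c e" if \<phi>: "\<phi> \<in> \<Phi>" and e: "e \<in> E" for \<phi> e
  proof -
    have uniq: "c e\<^sub>0 = c e" if "e\<^sub>0 \<in> E" "\<psi> \<in> \<Phi>" "\<iota> \<phi> ` e = \<iota> \<psi> ` e\<^sub>0" for e\<^sub>0 \<psi>
    proof -
      have lab: "\<pi> ` e = \<pi> ` e\<^sub>0"
        using \<pi>'img that(3) by metis
      show ?thesis
      \<comment> \<open>Edges shared between copies carry the label pair \<open>{i, j}\<close>,
        which is in \<open>C\<close>, so \<open>\<chi>\<close> gives their colour. Any other edge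
        has a private end, which determines the copy.\<close>
      proof (cases "\<pi> ` e = {i, j}")
        case True
        then show ?thesis
          using canon e that(1) lab ij(1) by metis
      next
        case False
        obtain x y where xy: "e = {x, y}"
          using e EV by (auto elim!: nsets2_E)
        then have "\<pi> x \<noteq> \<pi> y"
          using proper e by blast
        then obtain z where z: "z \<in> e" "\<pi> z \<notin> {i, j}"
          using False xy by auto
        then have "Private \<phi> z \<in> \<iota> \<psi> ` e\<^sub>0"
          using priv[OF z(2), of \<phi>] that(3) by (metis imageI)
        then have "\<psi> = \<phi>"
          by (auto simp: \<iota>_def split: if_splits)
        moreover have "e \<subseteq> V" "e\<^sub>0 \<subseteq> V"
          using EV e that(1) by (auto simp: nsets_def)
        ultimately have "e = e\<^sub>0"
          using that(3) inj_on_image_eq_iff[OF \<iota>inj[OF \<phi>]] by blast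
        then show ?thesis
          by simp
      qed
    qed
    have "\<exists>e\<^sub>0. e\<^sub>0 \<in> E \<and> (\<exists>\<psi>\<in>\<Phi>. \<iota> \<phi> ` e = \<iota> \<psi> ` e\<^sub>0)"
      using \<phi> e by blast
    from someI_ex[OF this] show ?thesis
      unfolding c'_def using uniq by blast
  qed
  have colour2: "c' {\<iota> \<phi> x, \<iota> \<phi> y} = c {x, y}" if "\<phi> \<in> \<Phi>" "{x, y} \<in> E" for \<phi> x y
    using colour[OF that] by simp
  have E'V': "E' \<subseteq> [V']\<^bsup>2\<^esup>"
  proof
    fix e assume "e \<in> E'"
    then obtain \<phi> e\<^sub>0 where e0: "\<phi> \<in> \<Phi>" "e\<^sub>0 \<in> E" "e = \<iota> \<phi> ` e\<^sub>0"
      by (auto simp: E'_def)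
    then obtain x y where xy: "e\<^sub>0 = {x, y}"
      using EV by (auto elim!: nsets2_E)
    then have "x \<in> V" "y \<in> V" "\<pi> x \<noteq> \<pi> y"
      using EVD proper e0 by auto
    then show "e \<in> [V']\<^bsup>2\<^esup>"
      using e0 xy \<iota>eq[OF e0(1)] by (auto simp: V'_def)
  qed
  have isPrivate: "\<exists>\<phi> v. w = Private \<phi> v" if "\<pi>' w \<notin> {i, j}" for w
    using that by (cases w) (auto simp: \<pi>'_def)
  \<comment> \<open>A clique has at most one vertex labelled \<open>i\<close> and one labelled
    \<open>j\<close>. As \<open>t > 2\<close>, it has a private vertex and so lies in one
    copy.\<close>
  have Kpull: "\<exists>\<phi>\<in>\<Phi>. \<exists>m\<^sub>0. (\<forall>k<t. m\<^sub>0 k \<in> V \<and> m k = \<iota> \<phi> (m\<^sub>0 k)) \<and> Kcopy E c a m\<^sub>0"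
    if m: "Kcopy E' c' a m" for a m
  proof -
    have lab: "\<pi>' (m k) \<noteq> \<pi>' (m l)" if "k < t" "l < t" "k \<noteq> l" for k l
      using proper' Kcopy_edge[OF m that(3,1,2)] by blast
    have "2 < t"
      using d_gt t_gt by simp
    have "\<exists>k<t. \<pi>' (m k) \<notin> {i, j}"
    proof (rule ccontr)
      assume "\<not> ?thesis"
      then have "\<pi>' (m k) = i \<or> \<pi>' (m k) = j" if "k < t" for k
        using that by auto
      from this[of 0] this[of 1] this[of 2] show False
        using lab[of 0 1] lab[of 0 2] lab[of 1 2] \<open>2 < t\<close> by auto
    qed
    then obtain k\<^sub>0 where k\<^sub>0: "k\<^sub>0 < t" "\<pi>' (m k\<^sub>0) \<notin> {i, j}"
      by blast
    obtain \<phi> v where \<phi>v: "m k\<^sub>0 = Private \<phi> v"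
      using isPrivate[OF k\<^sub>0(2)] by blast
    have nb: "{Private \<phi> v, m k} \<in> E'" if "k < t" "k \<noteq> k\<^sub>0" for k
      using Kcopy_edge[OF m] that k\<^sub>0(1) \<phi>v by metis
    have "\<exists>k1<t. k1 \<noteq> k\<^sub>0"
      using \<open>2 < t\<close> by (intro exI[of _ "if k\<^sub>0 = 0 then 1 else 0"]) auto
    then have \<phi>: "\<phi> \<in> \<Phi>" and v: "v \<in> V"
      using adj[OF nb] by blast+
    have "\<pi> v \<notin> {i, j}"
      using k\<^sub>0(2) \<phi>v by (simp add: \<pi>'_def)
    then have "m k\<^sub>0 = \<iota> \<phi> v"
      using priv \<phi>v by simp
    then have "\<exists>y. k < t \<longrightarrow> y \<in> V \<and> m k = \<iota> \<phi> y" for k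
      using adj[OF nb, of k] v by (cases "k = k\<^sub>0") blast+
    then obtain m\<^sub>0 where m\<^sub>0: "\<And>k. k < t \<Longrightarrow> m\<^sub>0 k \<in> V \<and> m k = \<iota> \<phi> (m\<^sub>0 k)"
      by metis
    have "{m\<^sub>0 k, m\<^sub>0 l} \<in> E \<and> c {m\<^sub>0 k, m\<^sub>0 l} = a" if "k < l" "l < t" for k l
    proof -
      have e: "{\<iota> \<phi> (m\<^sub>0 k), \<iota> \<phi> (m\<^sub>0 l)} \<in> E'" "c' {\<iota> \<phi> (m\<^sub>0 k), \<iota> \<phi> (m\<^sub>0 l)} = a"
        using Kcopy_edge[OF m, of k l] m\<^sub>0[of k] m\<^sub>0[of l] that by auto
      then have "{m\<^sub>0 k, m\<^sub>0 l} \<in> E"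
        using induced[OF \<phi>] m\<^sub>0 that by (meson order.strict_trans)
      then show ?thesis
        using colour2[OF \<phi>] e(2) by simp
    qed
    then have "Kcopy E c a m\<^sub>0"
      by (simp add: Kcopy_def)
    then show ?thesis
      using \<phi> m\<^sub>0 by blast
  qed
  have noH': "\<not> Hcopy E' c' a m" for a m
  proof
    assume m: "Hcopy E' c' a m"
    obtain \<phi> m\<^sub>0 where \<phi>: "\<phi> \<in> \<Phi>" and m\<^sub>0: "\<And>k. k < t \<Longrightarrow> m\<^sub>0 k \<in> V \<and> m k = \<iota> \<phi> (m\<^sub>0 k)"
      and K: "Kcopy E c a m\<^sub>0"
      using Kpull[OF Hcopy_Kcopy[OF m]] by blast
    have wk: "{m t, m k} \<in> E'" if "k < d" for k
      using Hcopy_edge[OF m hadj_apex[OF that]] by (simp add: insert_commute)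
    have m01: "{m 0, m 1} \<in> E'"
      using Hcopy_edge[OF m hadj_clique[of 0 1]] d_gt t_gt by simp
    have lab01: "\<pi>' (m k) = \<pi> (m\<^sub>0 k)" if "k < 2" for k
      using m\<^sub>0[of k] that d_gt t_gt \<pi>\<iota> by simp
    have "\<exists>y\<in>V. m t = \<iota> \<phi> y"
    proof (cases "\<pi>' (m t) \<in> {i, j}")
      case True
      \<comment> \<open>The apex forms a triangle with the vertices \<open>0\<close> and
        \<open>1\<close>; three distinct labels cannot all be in \<open>{i, j}\<close>.\<close>
      have "\<exists>k<2. \<pi>' (m k) \<notin> {i, j}"
      proof -
        have "\<pi>' (m t) \<noteq> \<pi>' (m 0)" "\<pi>' (m t) \<noteq> \<pi>' (m 1)" "\<pi>' (m 0) \<noteq> \<pi>' (m 1)"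
          using proper' wk[of 0] wk[of 1] m01 d_gt by auto
        then have "\<pi>' (m 0) \<notin> {i, j} \<or> \<pi>' (m 1) \<notin> {i, j}"
          using True by auto
        then show ?thesis
          by (metis one_less_numeral_iff semiring_norm(76) zero_less_numeral)
      qed
      then obtain k where k: "k < 2" "\<pi>' (m k) \<notin> {i, j}"
        by blast
      have "k < d" "k < t"
        using k(1) d_gt t_gt by auto
      then have "m k = Private \<phi> (m\<^sub>0 k)"
        using m\<^sub>0[of k] priv k(2) lab01[OF k(1)] by metis
      then have "{Private \<phi> (m\<^sub>0 k), m t} \<in> E'"
        using wk[OF \<open>k < d\<close>] by (simp add: insert_commute)
      then show ?thesis
        using adj by blast
    next
      case False
      then obtain \<psi> v where \<psi>: "m t = Private \<psi> v"
        using isPrivate by blast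
      have y: "\<psi> \<in> \<Phi> \<and> v \<in> V \<and> (\<exists>y\<in>V. m k = \<iota> \<psi> y)" if "k < d" for k
        using adj[of \<psi> v "m k"] wk[OF that] \<psi> by auto
      have v: "m t = \<iota> \<psi> v" "v \<in> V"
        using False \<psi> priv[of v \<psi>] y[of 0] d_gt by (auto simp: \<pi>'_def)
      \<comment> \<open>If the apex were private to a different copy, its neighbours
        \<open>0\<close> and \<open>1\<close> would lie in both copies and carry the labels
        \<open>i\<close> and \<open>j\<close>. The clique clause of \<open>admissible\<close>
        excludes this.\<close>
      have "\<psi> = \<phi>"
      proof (rule ccontr)
        assume ne: "\<psi> \<noteq> \<phi>"
        have "\<pi> (m\<^sub>0 k) \<in> {i, j}" if k: "k < 2" for k
        proof (rule ccontr)
          assume "\<pi> (m\<^sub>0 k) \<notin> {i, j}"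
          then have "m k = Private \<phi> (m\<^sub>0 k)"
            using priv m\<^sub>0[of k] k d_gt t_gt by auto
          moreover obtain y where "m k = \<iota> \<psi> y"
            using y[of k] k d_gt by auto
          ultimately show False
            using ne by (auto simp: \<iota>_def split: if_splits)
        qed
        from this[of 0] this[of 1] have "\<pi> (m\<^sub>0 0) \<in> {i, j}" "\<pi> (m\<^sub>0 1) \<in> {i, j}"
          by auto
        moreover have "\<pi> (m\<^sub>0 0) \<noteq> \<pi> (m\<^sub>0 1)"
          using proper'[OF m01] lab01 by simp
        ultimately have "{\<pi> (m\<^sub>0 0), \<pi> (m\<^sub>0 1)} = {i, j}"
          by auto
        then show False
          using noK[OF K, of 0 1] ij(1) d_gt t_gt by simp
      qed
      then show ?thesis
        using v by blast
    qed
    then obtain y where y: "y \<in> V" "m t = \<iota> \<phi> y"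
      by blast
    define m\<^sub>1 where "m\<^sub>1 = m\<^sub>0(t := y)"
    have m\<^sub>1: "m\<^sub>1 k \<in> V \<and> m k = \<iota> \<phi> (m\<^sub>1 k)" if "k \<le> t" for k
      using that y m\<^sub>0[of k] by (auto simp: m\<^sub>1_def)
    have "inj_on m\<^sub>1 {..t}"
    proof (rule inj_onI)
      fix k l assume "k \<in> {..t}" "l \<in> {..t}" "m\<^sub>1 k = m\<^sub>1 l"
      moreover from this have "m k = m l"
        using m\<^sub>1[of k] m\<^sub>1[of l] by simp
      ultimately show "k = l"
        using m by (auto simp: Hcopy_def inj_on_def)
    qed
    moreover have "{m\<^sub>1 k, m\<^sub>1 l} \<in> E \<and> c {m\<^sub>1 k, m\<^sub>1 l} = a" if kl: "hadj k l" for k l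
    proof -
      have le: "k \<le> t" "l \<le> t"
        using hadj_less[OF kl] by auto
      then have e: "{\<iota> \<phi> (m\<^sub>1 k), \<iota> \<phi> (m\<^sub>1 l)} \<in> E'" "c' {\<iota> \<phi> (m\<^sub>1 k), \<iota> \<phi> (m\<^sub>1 l)} = a"
        using Hcopy_edge[OF m kl] m\<^sub>1[of k] m\<^sub>1[of l] by auto
      then have "{m\<^sub>1 k, m\<^sub>1 l} \<in> E"
        using induced[OF \<phi>] m\<^sub>1 le by blast
      then show ?thesis
        using colour2[OF \<phi>] e(2) by simp
    qed
    ultimately have "Hcopy E c a m\<^sub>1"
      by (simp add: Hcopy_def)
    then show False
      using noH by blast
  qed
  have adm': "admissible C \<chi> V' E' \<pi>' c'"
    unfolding admissible_def
  proof (intro conjI allI impI ballI)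
    show "finite V'"
      using fin\<Phi> finV by (simp add: V'_def)
    show "E' \<subseteq> [V']\<^bsup>2\<^esup>"
      by (rule E'V')
    show "\<pi>' x \<noteq> \<pi>' y" if "{x, y} \<in> E'" for x y
      using proper'[OF that] .
    show "c' e = \<chi> (\<pi>' ` e)" if e: "e \<in> E'" "\<pi>' ` e \<in> C" for e
    proof -
      obtain \<phi> e\<^sub>0 where "\<phi> \<in> \<Phi>" "e\<^sub>0 \<in> E" "e = \<iota> \<phi> ` e\<^sub>0"
        using e(1) by (auto simp: E'_def)
      then show ?thesis
        using colour canon e(2) \<pi>'img by metis
    qed
    show "\<not> Hcopy E' c' a m" for a m
      by (rule noH')
    show "{\<pi>' (m k), \<pi>' (m l)} \<notin> C" if m: "Kcopy E' c' a m" and kl: "k < l" "l < t" for a m k l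
    proof -
      obtain \<phi> m\<^sub>0 where "\<forall>k<t. m\<^sub>0 k \<in> V \<and> m k = \<iota> \<phi> (m\<^sub>0 k)" "Kcopy E c a m\<^sub>0"
        using Kpull[OF m] by blast
      then show ?thesis
        using noK[of a m\<^sub>0 k l] kl \<pi>\<iota> by simp
    qed
  qed
  have "forcing (insert {i, j} C') V\<^sub>0 E\<^sub>0 \<pi>\<^sub>0 V' E' \<pi>'"
    unfolding forcing_def
  proof
    fix \<kappa> :: "(nat \<times> nat, nat \<Rightarrow> nat, (nat \<Rightarrow> nat \<times> nat) \<times> (nat \<Rightarrow> nat \<Rightarrow> nat), nat) glued set \<Rightarrow> colour"
    \<comment> \<open>Pick a host copy that is monochromatic on \<open>{i, j}\<close>, then use the
      earlier forcing inside the copy of the whole graph completed on it.\<close>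
    obtain f g a where fg: "inj_on f X" "f ` X \<subseteq> X'" "inj_on g Y" "g ` Y \<subseteq> Y'"
      "\<forall>x\<in>X. \<forall>y\<in>Y. R' (f x) (g y) \<longleftrightarrow> {x, y} \<in> E"
      "\<forall>x\<in>X. \<forall>y\<in>Y. {x, y} \<in> E \<longrightarrow> \<kappa> {LeftPart (f x), RightPart (g y)} = a"
      using ramsey[of "\<lambda>p q. \<kappa> {LeftPart p, RightPart q}"] by blast
    define \<phi> where "\<phi> = (restrict f X, restrict g Y)"
    have \<phi>: "\<phi> \<in> \<Phi>"
      using fg(1-5) by (auto simp: \<phi>_def \<Phi>_def inj_on_def)
    obtain \<psi> \<rho> where \<psi>: "inj_on \<psi> V\<^sub>0" "\<psi> ` V\<^sub>0 \<subseteq> V" "\<forall>v\<in>V\<^sub>0. \<pi> (\<psi> v) = \<pi>\<^sub>0 v"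
      "\<forall>e\<in>E\<^sub>0. \<psi> ` e \<in> E \<and> (\<pi>\<^sub>0 ` e \<in> C' \<longrightarrow> \<kappa> (\<iota> \<phi> ` \<psi> ` e) = \<rho> (\<pi>\<^sub>0 ` e))"
      using forc[unfolded forcing_def, THEN spec, of "\<lambda>e. \<kappa> (\<iota> \<phi> ` e)"] by blast
    have mono: "\<kappa> (\<iota> \<phi> ` e) = a" if e: "e \<in> E" "\<pi> ` e = {i, j}" for e
    proof -
      obtain x y where xy: "e = {x, y}" "x \<in> V" "y \<in> V"
        using e(1) EV by (auto elim!: nsets2_E)
      then have "\<pi> x = i \<and> \<pi> y = j \<or> \<pi> x = j \<and> \<pi> y = i"
        using e(2) by (auto simp: doubleton_eq_iff)
      then obtain p q where pq: "e = {p, q}" "p \<in> X" "q \<in> Y"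
        using xy by (auto simp: X_def Y_def insert_commute)
      then have "\<iota> \<phi> ` e = {LeftPart (f p), RightPart (g q)}"
        using XY by (auto simp: \<iota>_def \<phi>_def)
      then show ?thesis
        using fg(6) pq e(1) by simp
    qed
    show "\<exists>\<phi> \<rho>. inj_on \<phi> V\<^sub>0 \<and> \<phi> ` V\<^sub>0 \<subseteq> V' \<and> (\<forall>v\<in>V\<^sub>0. \<pi>' (\<phi> v) = \<pi>\<^sub>0 v) \<and>
       (\<forall>e\<in>E\<^sub>0. \<phi> ` e \<in> E' \<and> (\<pi>\<^sub>0 ` e \<in> insert {i, j} C' \<longrightarrow> \<kappa> (\<phi> ` e) = \<rho> (\<pi>\<^sub>0 ` e)))"
    proof (intro exI[of _ "\<iota> \<phi> \<circ> \<psi>"] exI[of _ "\<rho>({i, j} := a)"] conjI ballI impI)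
      show "inj_on (\<iota> \<phi> \<circ> \<psi>) V\<^sub>0"
        using \<psi>(1,2) \<iota>inj[OF \<phi>] by (meson comp_inj_on inj_on_subset)
      show "(\<iota> \<phi> \<circ> \<psi>) ` V\<^sub>0 \<subseteq> V'"
        using \<psi>(2) \<phi> by (auto simp: V'_def)
      show "\<pi>' ((\<iota> \<phi> \<circ> \<psi>) v) = \<pi>\<^sub>0 v" if "v \<in> V\<^sub>0" for v
        using \<psi>(3) that \<pi>\<iota> by simp
      show "(\<iota> \<phi> \<circ> \<psi>) ` e \<in> E'" if "e \<in> E\<^sub>0" for e
        unfolding image_comp[symmetric] E'_def using \<psi>(4) that \<phi> by blast
      show "\<kappa> ((\<iota> \<phi> \<circ> \<psi>) ` e) = (\<rho>({i, j} := a)) (\<pi>\<^sub>0 ` e)"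
        if e: "e \<in> E\<^sub>0" "\<pi>\<^sub>0 ` e \<in> insert {i, j} C'" for e
      proof -
        have "e \<subseteq> V\<^sub>0"
          using E\<^sub>0 e(1) by (auto simp: nsets_def)
        then have "\<pi> ` \<psi> ` e = \<pi>\<^sub>0 ` e"
          unfolding image_image using \<psi>(3) by (intro image_cong) auto
        then show ?thesis
          unfolding image_comp[symmetric] using \<psi>(4) e mono[of "\<psi> ` e"]
          by (cases "\<pi>\<^sub>0 ` e = {i, j}") auto
      qed
    qed
  qed
  moreover obtain h :: "(nat \<times> nat, nat \<Rightarrow> nat, (nat \<Rightarrow> nat \<times> nat) \<times> (nat \<Rightarrow> nat \<Rightarrow> nat), nat) glued \<Rightarrow> nat"
    where "inj_on h V'"
    using finite_imp_inj_to_nat_seg[of V'] adm' by (auto simp: admissible_def)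
  ultimately show ?thesis
    using admissible_transfer[OF adm' _ E\<^sub>0] by blast
qed

text \<open>One amalgamation per pair in \<open>C\<close>. What is forced for earlier pairs
  survives, because the old forcing property is applied inside one copy. The start is
  \<open>V\<^sub>0\<close> itself with no pair treated.\<close>

theorem canonisation:
  fixes V\<^sub>0 :: "'u set"
  assumes adm: "admissible C \<chi> V\<^sub>0 E\<^sub>0 \<pi>\<^sub>0 c\<^sub>0" and C: "finite C" "\<And>p. p \<in> C \<Longrightarrow> card p = 2"
  shows "\<exists>(V :: nat set) E \<pi> c. admissible C \<chi> V E \<pi> c \<and> forcing C V\<^sub>0 E\<^sub>0 \<pi>\<^sub>0 V E \<pi>"
proof -
  have E\<^sub>0: "E\<^sub>0 \<subseteq> [V\<^sub>0]\<^bsup>2\<^esup>" and fin: "finite V\<^sub>0"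
    using adm by (auto simp: admissible_def)
  have "\<exists>(V :: nat set) E \<pi> c. admissible C \<chi> V E \<pi> c \<and> forcing C' V\<^sub>0 E\<^sub>0 \<pi>\<^sub>0 V E \<pi>"
    if "C' \<subseteq> C" for C'
    using finite_subset[OF that C(1)] that
  proof (induction rule: finite_induct)
    case empty
    have "forcing {} V\<^sub>0 E\<^sub>0 \<pi>\<^sub>0 V\<^sub>0 E\<^sub>0 \<pi>\<^sub>0"
      unfolding forcing_def by (intro allI exI[of _ id]) auto
    moreover obtain h :: "'u \<Rightarrow> nat" where "inj_on h V\<^sub>0"
      using finite_imp_inj_to_nat_seg[OF fin] by blast
    ultimately show ?case
      using admissible_transfer[OF adm _ E\<^sub>0] by blast
  next
    case (insert p C')
    then obtain V :: "nat set" and E \<pi> c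
      where P: "admissible C \<chi> V E \<pi> c" "forcing C' V\<^sub>0 E\<^sub>0 \<pi>\<^sub>0 V E \<pi>"
      by blast
    have "card p = 2" "p \<in> C"
      using C(2) insert.prems by auto
    then obtain i j where ij: "p = {i, j}" "i \<noteq> j"
      by (meson card_2_iff)
    show ?case
      using amalgamation_step[OF P E\<^sub>0, of i j] ij \<open>p \<in> C\<close> by simp
  qed
  then show ?thesis
    by blast
qed

end

subsection \<open>Attaching copies of H to edges\<close>

definition ends :: "'v set \<Rightarrow> 'v \<times> 'v" where
  "ends f = (SOME p. f = {fst p, snd p} \<and> fst p \<noteq> snd p)"

lemma ends:
  assumes "f \<in> [V]\<^bsup>2\<^esup>"
  shows "f = {fst (ends f), snd (ends f)}" "fst (ends f) \<noteq> snd (ends f)"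
proof -
  from assms obtain x y where "f = {x, y}" "x \<noteq> y"
    by (auto elim!: nsets2_E)
  then have "\<exists>p. f = {fst p, snd p} \<and> fst p \<noteq> snd p"
    by (intro exI[of _ "(x, y)"]) simp
  from someI_ex[OF this] show "f = {fst (ends f), snd (ends f)}" "fst (ends f) \<noteq> snd (ends f)"
    by (simp_all add: ends_def)
qed

text \<open>A copy of \<open>H\<close> in which the edge \<open>{0, 1}\<close> (both ends adjacent to the apex \<open>t\<close>) is the edge \<open>f\<close> and
  the vertices \<open>2, \<dots>, t\<close> are new.\<close>

definition gadget :: "'v set \<Rightarrow> nat \<Rightarrow> 'v + 'v set \<times> nat" where
  "gadget f k = (if k = 0 then Inl (fst (ends f)) else if k = 1 then Inl (snd (ends f)) else Inr (f, k - 2))"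

lemma gadget_eq_Inr: "gadget f k = Inr (g, i) \<longleftrightarrow> g = f \<and> k = i + 2"
  by (auto simp: gadget_def)

lemma gadget_eq_Inl: "gadget f k = Inl x \<longleftrightarrow> k = 0 \<and> x = fst (ends f) \<or> k = 1 \<and> x = snd (ends f)"
  by (auto simp: gadget_def)

lemma gadget_inj: "f \<in> [V]\<^bsup>2\<^esup> \<Longrightarrow> gadget f k = gadget f l \<longleftrightarrow> k = l"
  using ends(2)[of f V] by (auto simp: gadget_def)

context almost_clique
begin

definition attach_verts :: "'v set \<Rightarrow> 'v set set \<Rightarrow> ('v + 'v set \<times> nat) set" where
  "attach_verts V X = Inl ` V \<union> Inr ` (X \<times> {..t - 2})"

text \<open>The condition \<open>1 < l\<close> drops only the edge between \<open>0\<close> and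
  \<open>1\<close> of a gadget, which is the given edge \<open>f\<close>.\<close>

definition attach_edges :: "'v set set \<Rightarrow> 'v set set \<Rightarrow> ('v + 'v set \<times> nat) set set" where
  "attach_edges E X = (`) Inl ` E \<union> {{gadget f k, gadget f l} | f k l. f \<in> X \<and> hadj k l \<and> 1 < l}"

text \<open>A gadget gets the colour opposite to that of \<open>f\<close>, so it would become a
  monochromatic copy of H if \<open>f\<close> changed colour. Each new edge has a new vertex, from
  which the choice operator recovers \<open>f\<close>.\<close>

definition attach_colour :: "('v set \<Rightarrow> colour) \<Rightarrow> ('v + 'v set \<times> nat) set \<Rightarrow> colour" where
  "attach_colour c e = (if e \<subseteq> range Inl then c (Inl -` e)
     else opposite (c (SOME f. \<exists>i. Inr (f, i) \<in> e)))"

lemma attach_colour_Inl [simp]: "attach_colour c (Inl ` e) = c e"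
  by (auto simp: attach_colour_def inj_vimage_image_eq)

lemma attach_colour_Inl2 [simp]: "attach_colour c {Inl x, Inl y} = c {x, y}"
  using attach_colour_Inl[of c "{x, y}"] by simp

lemma attach_colour_gadget: "1 < l \<Longrightarrow> attach_colour c {gadget f k, gadget f l} = opposite (c f)"
proof -
  assume l: "1 < l"
  have "(SOME g. \<exists>i. Inr (g, i) \<in> {gadget f k, gadget f l}) = f"
  proof (rule some_equality)
    show "\<exists>i. Inr (f, i) \<in> {gadget f k, gadget f l}"
      using l by (intro exI[of _ "l - 2"]) (simp add: gadget_def)
  next
    fix g
    assume "\<exists>i. Inr (g, i) \<in> {gadget f k, gadget f l}"
    then show "g = f"
      by (metis gadget_eq_Inr insertE singletonD)
  qed
  moreover have "gadget f l \<notin> range Inl"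
    using l by (auto simp: gadget_def)
  ultimately show ?thesis
    by (simp add: attach_colour_def)
qed

lemma finite_attach_verts: "finite V \<Longrightarrow> E \<subseteq> [V]\<^bsup>2\<^esup> \<Longrightarrow> X \<subseteq> E \<Longrightarrow> finite (attach_verts V X)"
  unfolding attach_verts_def using finite_imp_finite_nsets[of V 2] by (auto dest: finite_subset)

lemma gadget_in_verts:
  assumes "E \<subseteq> [V]\<^bsup>2\<^esup>" "X \<subseteq> E" "f \<in> X" "k \<le> t"
  shows "gadget f k \<in> attach_verts V X"
proof -
  have "f \<in> [V]\<^bsup>2\<^esup>"
    using assms by blast
  moreover from ends(1)[OF this] this have "fst (ends f) \<in> V" "snd (ends f) \<in> V"
    by (metis doubleton_in_nsets_2)+
  ultimately show ?thesis
    using assms by (auto simp: gadget_def attach_verts_def)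
qed

lemma gadget_edge:
  assumes "E \<subseteq> [V]\<^bsup>2\<^esup>" "X \<subseteq> E" "f \<in> X" "hadj k l"
  shows "{gadget f k, gadget f l} \<in> attach_edges E X"
proof (cases "1 < l")
  case True
  then show ?thesis
    using assms by (auto simp: attach_edges_def)
next
  case False
  then have "k = 0" "l = 1"
    using hadj_less[OF assms(4)] by auto
  moreover have "f \<in> [V]\<^bsup>2\<^esup>"
    using assms by blast
  ultimately have "{gadget f k, gadget f l} = Inl ` f"
    using ends(1)[of f V] by (simp add: gadget_def) (metis image_empty image_insert)
  then show ?thesis
    using assms by (auto simp: attach_edges_def)
qed

lemma attach_edges_nsets:
  assumes "E \<subseteq> [V]\<^bsup>2\<^esup>" "X \<subseteq> E"
  shows "attach_edges E X \<subseteq> [attach_verts V X]\<^bsup>2\<^esup>"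
proof
  fix e assume "e \<in> attach_edges E X"
  then consider e' where "e' \<in> E" "e = Inl ` e'"
    | f k l where "f \<in> X" "hadj k l" "e = {gadget f k, gadget f l}"
    by (auto simp: attach_edges_def)
  then show "e \<in> [attach_verts V X]\<^bsup>2\<^esup>"
  proof cases
    case 1
    then obtain x y where "e' = {x, y}" "x \<in> V" "y \<in> V" "x \<noteq> y"
      using assms(1) by (auto elim!: nsets2_E)
    then show ?thesis
      using 1 by (auto simp: attach_verts_def)
  next
    case 2
    then have "k \<le> t" "l \<le> t" "k \<noteq> l" "f \<in> [V]\<^bsup>2\<^esup>"
      using hadj_less[OF 2(2)] assms by auto
    then show ?thesis
      using gadget_in_verts[OF assms 2(1)] gadget_inj[of f V k l] 2 by auto
  qed
qed

lemma attach_edge_Inl: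
  fixes x y :: 'v
  assumes "{Inl x, Inl y} \<in> attach_edges E X"
  shows "{x, y} \<in> E"
proof -
  let ?e = "{Inl x, Inl y} :: ('v + 'v set \<times> nat) set"
  from assms consider e where "e \<in> E" "?e = Inl ` e"
    | f k l where "?e = {gadget f k, gadget f l}" "1 < l"
    unfolding attach_edges_def by blast
  then show ?thesis
  proof cases
    case 1
    then have "(Inl :: _ \<Rightarrow> 'v + 'v set \<times> nat) ` {x, y} = Inl ` e"
      by simp
    then have "{x, y} = e"
      by (meson inj_Inl inj_image_eq_iff)
    then show ?thesis
      using 1 by simp
  next
    case 2
    then have "gadget f l = Inl x \<or> gadget f l = Inl y"
      by (metis insertCI insertE singletonD)
    then show ?thesis
      using 2(2) by (auto simp: gadget_eq_Inl)
  qed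
qed

lemma attach_edge_Inr:
  assumes "{Inr (f, i), q} \<in> attach_edges E X"
  shows "f \<in> X \<and> (\<exists>l. q = gadget f l \<and> l \<le> t \<and> (hadj l (i + 2) \<or> hadj (i + 2) l)) \<and>
    attach_colour c {Inr (f, i), q} = opposite (c f)"
proof -
  from assms consider e where "{Inr (f, i), q} = Inl ` e"
    | g k l where "{Inr (f, i), q} = {gadget g k, gadget g l}" "g \<in> X" "hadj k l" "1 < l"
    unfolding attach_edges_def by blast
  then show ?thesis
  proof cases
    case 1
    then show ?thesis
      by (metis Inl_Inr_False imageE insertI1)
  next
    case 2
    have col: "attach_colour c {Inr (f, i), q} = opposite (c g)"
      using 2(1) attach_colour_gadget[OF 2(4)] by simp
    have le: "k \<le> t" "l \<le> t"
      using hadj_less[OF 2(3)] by auto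
    from 2(1) have "Inr (f, i) = gadget g k \<and> q = gadget g l \<or> Inr (f, i) = gadget g l \<and> q = gadget g k"
      by (auto simp: doubleton_eq_iff)
    then show ?thesis
    proof
      assume a: "Inr (f, i) = gadget g k \<and> q = gadget g l"
      then have "f = g" "k = i + 2"
        using gadget_eq_Inr[of g k f i] by auto
      then show ?thesis
        using a col 2(2,3) le by blast
    next
      assume a: "Inr (f, i) = gadget g l \<and> q = gadget g k"
      then have "f = g" "l = i + 2"
        using gadget_eq_Inr[of g l f i] by auto
      then show ?thesis
        using a col 2(2,3) le by blast
    qed
  qed
qed

text \<open>A monochromatic K_t with a new vertex lies in one gadget, which has \<open>t + 1\<close>
  vertices. It misses \<open>0\<close> or \<open>1\<close>, since \<open>f\<close> has the other
  colour, and it misses \<open>t - 1\<close> or \<open>t\<close>, which are not adjacent. So at most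
  \<open>t - 1\<close> vertices remain.\<close>

lemma attach_Kcopy:
  assumes E: "E \<subseteq> [V]\<^bsup>2\<^esup>" "X \<subseteq> E"
    and m: "Kcopy (attach_edges E X) (attach_colour c) a m" and k: "k < t"
  shows "m k \<in> range Inl"
proof (rule ccontr)
  assume "m k \<notin> range Inl"
  then obtain f i where fi: "m k = Inr (f, i)"
    by (cases "m k") auto
  have nb: "{Inr (f, i), m l} \<in> attach_edges E X \<and> attach_colour c {Inr (f, i), m l} = a"
    if "l < t" "l \<noteq> k" for l
    using Kcopy_edge[OF m that(2)[symmetric] k that(1)] fi by simp
  have ex: "\<exists>l<t. l \<noteq> k"
    using d_gt t_gt by (intro exI[of _ "if k = 0 then 1 else 0"]) auto
  then have fX: "f \<in> X" and col: "a = opposite (c f)"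
    using nb attach_edge_Inr[of f i _ E X c] by metis+
  have f2: "f \<in> [V]\<^bsup>2\<^esup>"
    using fX E by blast
  have "\<exists>j\<le>t. m l = gadget f j" if l: "l < t" for l
  proof (cases "l = k")
    case True
    obtain l' where "l' < t" "l' \<noteq> k"
      using ex by blast
    then obtain j where "hadj j (i + 2) \<or> hadj (i + 2) j"
      using attach_edge_Inr[of f i "m l'" E X c] nb by blast
    then have "i + 2 \<le> t"
      by (auto dest!: hadj_less)
    then show ?thesis
      using True fi by (intro exI[of _ "i + 2"]) (simp add: gadget_def)
  next
    case False
    then show ?thesis
      using attach_edge_Inr[of f i "m l" E X c] nb l by blast
  qed
  then obtain \<sigma> where \<sigma>: "\<And>l. l < t \<Longrightarrow> \<sigma> l \<le> t \<and> m l = gadget f (\<sigma> l)"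
    by metis
  have inj: "inj_on \<sigma> {..<t}"
  proof (rule inj_onI, rule ccontr)
    fix p q assume pq: "p \<in> {..<t}" "q \<in> {..<t}" "\<sigma> p = \<sigma> q" "p \<noteq> q"
    then have "m p = m q"
      using \<sigma> by simp
    moreover have "{m p, m q} \<in> [attach_verts V X]\<^bsup>2\<^esup>"
      using Kcopy_edge[OF m pq(4)] pq attach_edges_nsets[OF E] by blast
    ultimately show False
      unfolding doubleton_in_nsets_2 by blast
  qed
  have edge: "{gadget f x, gadget f y} \<in> attach_edges E X \<and> attach_colour c {gadget f x, gadget f y} = a"
    if "x \<in> \<sigma> ` {..<t}" "y \<in> \<sigma> ` {..<t}" "x \<noteq> y" for x y
  proof -
    from that obtain p q where "p < t" "q < t" "x = \<sigma> p" "y = \<sigma> q"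
      by auto
    then show ?thesis
      using Kcopy_edge[OF m, of p q] \<sigma>[of p] \<sigma>[of q] that(3) by auto
  qed
  have t3: "3 \<le> t"
    using d_gt t_gt by simp
  have "\<exists>x\<in>{0, 1}. x \<notin> \<sigma> ` {..<t}"
  proof (rule ccontr)
    assume "\<not> ?thesis"
    then have "attach_colour c {gadget f 0, gadget f 1} = a"
      using edge[of 0 1] by auto
    then have "c f = a"
      using ends(1)[OF f2] by (simp add: gadget_def)
    then show False
      using col by simp
  qed
  then obtain x where x: "x \<in> {0, 1}" "x \<notin> \<sigma> ` {..<t}"
    by blast
  have "\<exists>y\<in>{t - 1, t}. y \<notin> \<sigma> ` {..<t}"
  proof (rule ccontr)
    assume "\<not> ?thesis"
    then have "{gadget f (t - 1), gadget f t} \<in> attach_edges E X"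
      using edge[of "t - 1" t] t3 by auto
    moreover have "gadget f (t - 1) = Inr (f, t - 3)"
      using t3 by (simp add: gadget_eq_Inr)
    ultimately have e: "{Inr (f, t - 3), gadget f t} \<in> attach_edges E X"
      by simp
    then obtain l where l: "gadget f t = gadget f l" "hadj l (t - 3 + 2) \<or> hadj (t - 3 + 2) l"
      using attach_edge_Inr[OF e] by blast
    have "l = t"
      using l(1) gadget_inj[OF f2, of t l] by simp
    moreover have "t - 3 + 2 = t - 1"
      using t3 by simp
    ultimately have "hadj t (t - 1) \<or> hadj (t - 1) t"
      using l(2) by simp
    then show False
      using t_gt by (auto simp: hadj_def)
  qed
  then obtain y where y: "y \<in> {t - 1, t}" "y \<notin> \<sigma> ` {..<t}"
    by blast
  have "\<sigma> ` {..<t} \<subseteq> {..t} - {x, y}"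
    using \<sigma> x y by auto
  then have "card (\<sigma> ` {..<t}) \<le> card ({..t} - {x, y})"
    by (intro card_mono) auto
  also have "card ({..t} - {x, y}) = t - 1"
    using x(1) y(1) t3 by (subst card_Diff_subset) auto
  finally show False
    using card_image[OF inj] t3 by simp
qed

text \<open>By \<open>attach_Kcopy\<close> only the apex can be a new vertex. Its neighbours are
  old, so \<open>0\<close> and \<open>1\<close> are mapped to the two ends of \<open>f\<close>,
  whose colour differs from that of the gadget.\<close>

lemma attach_no_Hcopy:
  assumes E: "E \<subseteq> [V]\<^bsup>2\<^esup>" "X \<subseteq> E" and noH: "\<And>a m. \<not> Hcopy E c a m"
  shows "\<not> Hcopy (attach_edges E X) (attach_colour c) a m"
proof
  assume m: "Hcopy (attach_edges E X) (attach_colour c) a m"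
  have K: "m k \<in> range Inl" if "k < t" for k
    using attach_Kcopy[OF E Hcopy_Kcopy[OF m] that] .
  show False
  proof (cases "m t")
    case (Inl w)
    then have "m k \<in> range Inl" if "k \<le> t" for k
      using K that by (cases "k = t") auto
    then have "\<exists>x. k \<le> t \<longrightarrow> m k = Inl x" for k
      by blast
    then obtain m' where m': "\<And>k. k \<le> t \<Longrightarrow> m k = Inl (m' k)"
      by metis
    have "{m' k, m' l} \<in> E \<and> c {m' k, m' l} = a" if kl: "hadj k l" for k l
    proof -
      have "m k = Inl (m' k)" "m l = Inl (m' l)"
        using hadj_less[OF kl] m' by auto
      then show ?thesis
        using Hcopy_edge[OF m kl] attach_edge_Inl by auto
    qed
    moreover have "inj_on m' {..t}"
      using m m' unfolding Hcopy_def inj_on_def by (metis atMost_iff)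
    ultimately have "Hcopy E c a m'"
      by (simp add: Hcopy_def)
    then show False
      using noH by blast
  next
    case (Inr p)
    then obtain f i where fi: "m t = Inr (f, i)"
      by (cases p) auto
    have nb: "{Inr (f, i), m k} \<in> attach_edges E X \<and> attach_colour c {Inr (f, i), m k} = a"
      if "k < d" for k
      using Hcopy_edge[OF m hadj_apex[OF that]] fi by (simp add: insert_commute)
    have fX: "f \<in> X" and a: "a = opposite (c f)"
      using attach_edge_Inr[of f i "m 0" E X c] nb[of 0] d_gt by auto
    have f2: "f \<in> [V]\<^bsup>2\<^esup>"
      using fX E by blast
    have low: "\<exists>j<2. m k = gadget f j" if k: "k < d" for k
    proof -
      obtain j where j: "m k = gadget f j"
        using attach_edge_Inr[of f i "m k" E X c] nb[OF k] by blast
      obtain x where x: "m k = Inl x"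
        using K[of k] k t_gt by auto
      have "j < 2"
        using j x gadget_eq_Inl[of f j x] by auto
      then show ?thesis
        using j by blast
    qed
    obtain j0 where j0: "j0 < 2" "m 0 = gadget f j0"
      using low[of 0] d_gt by auto
    obtain j1 where j1: "j1 < 2" "m 1 = gadget f j1"
      using low[of 1] d_gt by auto
    have "m 0 \<noteq> m 1"
      using m d_gt t_gt inj_onD[of m "{..t}" 0 1] by (auto simp: Hcopy_def)
    then have "{j0, j1} = {0, 1}"
      using j0 j1 by (auto simp: less_2_cases_iff)
    then have "{m 0, m 1} = gadget f ` {0, 1}"
      using j0 j1 by (metis image_empty image_insert)
    also have "\<dots> = Inl ` {fst (ends f), snd (ends f)}"
      by (auto simp: gadget_def)
    finally have "{m 0, m 1} = Inl ` f"
      using ends(1)[OF f2] by simp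
    then have "c f = a"
      using Hcopy_edge[OF m hadj_clique[of 0 1]] d_gt t_gt by simp
    then show False
      using a by simp
  qed
qed

end

subsection \<open>Unavoidable patterns\<close>

context almost_clique
begin

definition mono_sets :: "nat \<Rightarrow> (nat set \<Rightarrow> colour) \<Rightarrow> nat set set" where
  "mono_sets N \<chi> = {T. T \<subseteq> {..<N} \<and> card T = t \<and> (\<exists>a. \<forall>x\<in>T. \<forall>y\<in>T. x \<noteq> y \<longrightarrow> \<chi> {x, y} = a)}"

lemma mono_setsE:
  assumes "T \<in> mono_sets N \<chi>"
  obtains a where "\<And>x y. x \<in> T \<Longrightarrow> y \<in> T \<Longrightarrow> x \<noteq> y \<Longrightarrow> \<chi> {x, y} = a"
proof -
  from assms obtain a where "\<forall>x\<in>T. \<forall>y\<in>T. x \<noteq> y \<longrightarrow> \<chi> {x, y} = a"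
    unfolding mono_sets_def mem_Collect_eq by (elim conjE exE)
  then show thesis
    using that[of a] by simp
qed

text \<open>\<open>N\<close> comes from Ramsey's theorem, so no colouring avoids monochromatic
  \<open>t\<close>-sets; a family of least cardinality is minimal under inclusion.\<close>

lemma minimal_colouring:
  obtains N \<chi> where "mono_sets N \<chi> \<noteq> {}"
    "\<And>\<chi>'. mono_sets N \<chi>' \<subseteq> mono_sets N \<chi> \<Longrightarrow> mono_sets N \<chi>' = mono_sets N \<chi>"
proof -
  obtain N where N: "\<And>(V :: nat set) E. finite V \<Longrightarrow> N \<le> card V \<Longrightarrow>
      \<exists>R\<subseteq>V. card R = t \<and> clique R E \<or> card R = t \<and> indep R E"
    using ramsey2[of t t, where 'a = nat] by blast
  have ne: "mono_sets N \<chi> \<noteq> {}" for \<chi>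
  proof -
    obtain R where R: "R \<subseteq> {..<N}" "card R = t" "clique R {e. \<chi> e = Red} \<or> indep R {e. \<chi> e = Red}"
      using N[of "{..<N}" "{e. \<chi> e = Red}"] by auto
    from R(3) have "\<exists>a. \<forall>x\<in>R. \<forall>y\<in>R. x \<noteq> y \<longrightarrow> \<chi> {x, y} = a"
    proof
      assume "clique R {e. \<chi> e = Red}"
      then show ?thesis
        by (intro exI[of _ Red]) (simp add: clique_def)
    next
      assume "indep R {e. \<chi> e = Red}"
      then show ?thesis
        using neq_opposite[of _ Red] by (intro exI[of _ Blue]) (simp add: indep_def)
    qed
    then have "R \<in> mono_sets N \<chi>"
      using R(1,2) by (simp add: mono_sets_def)
    then show ?thesis
      by blast
  qed
  have fin: "finite (mono_sets N \<chi>)" for \<chi>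
    by (rule finite_subset[of _ "Pow {..<N}"]) (auto simp: mono_sets_def)
  obtain \<chi> where \<chi>: "\<And>\<chi>'. card (mono_sets N \<chi>) \<le> card (mono_sets N \<chi>')"
    using ex_has_least_nat[of "\<lambda>_. True" _ "\<lambda>\<chi>. card (mono_sets N \<chi>)"] by auto
  show thesis
  proof (rule that[OF ne])
    fix \<chi>'
    assume "mono_sets N \<chi>' \<subseteq> mono_sets N \<chi>"
    then show "mono_sets N \<chi>' = mono_sets N \<chi>"
      using card_seteq[OF fin] \<chi> by blast
  qed
qed

text \<open>The vertices \<open>t - 1\<close> and \<open>t\<close> are not adjacent, as d \<le> t -
  1, so identifying them is a homomorphism from H to K_t.\<close>

lemma hadj_fold: "hadj k l \<Longrightarrow> min k (t - 1) < min l (t - 1)"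
  using t_gt by (auto simp: hadj_def min_def)

text \<open>Take a colouring \<open>\<chi>\<close> of \<open>K\<^sub>N\<close> whose family of monochromatic \<open>t\<close>-sets is minimal. Since \<open>d < t\<close>, the
  graph \<open>H\<close> can be folded onto \<open>K\<^sub>t\<close> by identifying its apex with the vertex \<open>t - 1\<close>. A graph that contains
  a folded copy of \<open>H\<close> over every non-monochromatic \<open>t\<close>-set forces, by minimality, the same
  monochromatic \<open>t\<close>-sets in the label colouring of any \<open>H\<close>-free colouring. Cloning a vertex \<open>s\<close> of one
  monochromatic set \<open>S\<close> gives labels \<open>N + idx u\<close> whose edges to \<open>S - {s}\<close> all get one forced colour,
  while edges between clones are unconstrained; two layers of gadgets over \<open>S - {s}\<close> then force every
  colour of the pattern placed on the clones, up to swapping the two colours.\<close>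

theorem unavoidable:
  fixes VP :: "'p set"
  assumes finP: "finite VP" and EP: "EP \<subseteq> [VP]\<^bsup>2\<^esup>" and noHP: "\<And>a m. \<not> Hcopy EP cP a m"
  shows "\<exists>(V :: nat set) E. finite V \<and> E \<subseteq> [V]\<^bsup>2\<^esup> \<and> (\<exists>c. \<forall>a m. \<not> Hcopy E c a m) \<and>
    (\<forall>k. (\<forall>a m. \<not> Hcopy E k a m) \<longrightarrow> (\<exists>\<phi>. inj_on \<phi> VP \<and> \<phi> ` VP \<subseteq> V \<and> (\<forall>e\<in>EP. \<phi> ` e \<in> E) \<and>
      ((\<forall>e\<in>EP. k (\<phi> ` e) = cP e) \<or> (\<forall>e\<in>EP. k (\<phi> ` e) = opposite (cP e)))))"
proof -
  have t3: "3 \<le> t"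
    using d_gt t_gt by simp
  obtain N \<chi> where ne: "mono_sets N \<chi> \<noteq> {}" and
    least: "\<And>\<chi>'. mono_sets N \<chi>' \<subseteq> mono_sets N \<chi> \<Longrightarrow> mono_sets N \<chi>' = mono_sets N \<chi>"
    using minimal_colouring by metis
  obtain S where S: "S \<in> mono_sets N \<chi>"
    using ne by blast
  then have SN: "S \<subseteq> {..<N}" and cardS: "card S = t"
    by (auto simp: mono_sets_def)
  obtain a\<^sub>0 where a\<^sub>0: "\<And>x y. x \<in> S \<Longrightarrow> y \<in> S \<Longrightarrow> x \<noteq> y \<Longrightarrow> \<chi> {x, y} = a\<^sub>0"
    using mono_setsE[OF S] by metis
  have "S \<noteq> {}"
    using cardS t3 by auto
  then obtain s where s: "s \<in> S"
    by blast
  have finS: "finite S"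
    using SN finite_subset by blast
  then have "card (S - {s}) = card {..t - 2}"
    using s cardS t3 by simp
  then obtain \<sigma> where \<sigma>: "bij_betw \<sigma> {..t - 2} (S - {s})"
    using finite_same_card_bij[OF finite_atMost finite_Diff[OF finS]] by metis
  have \<sigma>S: "\<sigma> i \<in> S" "\<sigma> i \<noteq> s" "\<sigma> i < N" if "i \<le> t - 2" for i
    using bij_betwE[OF \<sigma>] SN that by auto
  have \<sigma>inj: "\<sigma> i = \<sigma> j \<longleftrightarrow> i = j" if "i \<le> t - 2" "j \<le> t - 2" for i j
    using bij_betw_imp_inj_on[OF \<sigma>] that by (auto simp: inj_on_def)
  \<comment> \<open>The first layer sits on the pattern edges of colour \<open>a\<^sub>0\<close> and
    gets the other colour. The second, on \<open>X2\<close>, sits on all edges not coloured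
    \<open>a\<^sub>0\<close>, those of the first layer included, and gets colour
    \<open>a\<^sub>0\<close>.\<close>
  define X1 where "X1 = {e \<in> EP. cP e = a\<^sub>0}"
  define VU where "VU = attach_verts VP X1"
  define EU where "EU = attach_edges EP X1"
  define cU :: "('p + 'p set \<times> nat) set \<Rightarrow> colour" where "cU = attach_colour cP"
  have X1: "X1 \<subseteq> EP"
    by (auto simp: X1_def)
  have EUV: "EU \<subseteq> [VU]\<^bsup>2\<^esup>"
    unfolding EU_def VU_def by (rule attach_edges_nsets[OF EP X1])
  have noHU: "\<not> Hcopy EU cU a m" for a m
    unfolding EU_def cU_def by (rule attach_no_Hcopy[OF EP X1 noHP])
  have finU: "finite VU"
    unfolding VU_def by (rule finite_attach_verts[OF finP EP X1])
  define X2 where "X2 = {e \<in> EU. cU e \<noteq> a\<^sub>0}"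
  define VD where "VD = attach_verts VU X2"
  define ED where "ED = attach_edges EU X2"
  define cD :: "(('p + 'p set \<times> nat) + ('p + 'p set \<times> nat) set \<times> nat) set \<Rightarrow> colour"
    where "cD = attach_colour cU"
  have X2: "X2 \<subseteq> EU"
    by (auto simp: X2_def)
  have EDV: "ED \<subseteq> [VD]\<^bsup>2\<^esup>"
    unfolding ED_def VD_def by (rule attach_edges_nsets[OF EUV X2])
  have noHD: "\<not> Hcopy ED cD a m" for a m
    unfolding ED_def cD_def by (rule attach_no_Hcopy[OF EUV X2 noHU])
  have KD: "m k \<in> range Inl" if "Kcopy ED cD a m" "k < t" for a m k
    using attach_Kcopy[OF EUV X2 that[unfolded ED_def cD_def]] .
  have finD: "finite VD"
    unfolding VD_def by (rule finite_attach_verts[OF finU EUV X2])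
  obtain idx :: "'p + 'p set \<times> nat \<Rightarrow> nat" where idx: "inj_on idx VU"
    using finite_imp_inj_to_nat_seg[OF finU] by blast
  have "\<exists>\<tau>. bij_betw \<tau> {..<t} T" if "T \<subseteq> {..<N}" "card T = t" for T :: "nat set"
    using finite_same_card_bij[of "{..<t}" T] that finite_subset by auto
  then obtain \<tau> where \<tau>: "\<And>T :: nat set. T \<subseteq> {..<N} \<Longrightarrow> card T = t \<Longrightarrow> bij_betw (\<tau> T) {..<t} T"
    by metis
  \<comment> \<open>A folded copy for each \<open>u\<close> as well as each \<open>T\<close>, so
    that minimality can be used for every clone separately.\<close>
  define I where "I = {T. T \<subseteq> {..<N} \<and> card T = t \<and> T \<notin> mono_sets N \<chi>} \<times> VU"
  define V0 where "V0 = Inl ` VD \<union> Inr ` (I \<times> {..t})"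
  define E0 where "E0 = (`) Inl ` ED \<union> {{Inr (p, k), Inr (p, l)} | p k l. p \<in> I \<and> hadj k l}"
  define clone where "clone u x = (if x = s then N + idx u else x)" for u x
  define \<kappa> where "\<kappa> x = (if N \<le> x then s else x)" for x
  \<comment> \<open>Pattern and first-layer vertices become clones. Second-layer vertices take
    labels in \<open>S - {s}\<close>, so every edge at them joins two labels of some cloned
    \<open>S\<close>.\<close>
  define labD where "labD w = (case w of Inl u \<Rightarrow> N + idx u | Inr fi \<Rightarrow> \<sigma> (snd fi))"
    for w :: "('p + 'p set \<times> nat) + ('p + 'p set \<times> nat) set \<times> nat"
  define \<pi>\<^sub>0 where "\<pi>\<^sub>0 w = (case w of Inl w' \<Rightarrow> labD w' | Inr ((T, u), k) \<Rightarrow> clone u (\<tau> T (min k (t - 1))))"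
    for w :: "(('p + 'p set \<times> nat) + ('p + 'p set \<times> nat) set \<times> nat) + ((nat set \<times> ('p + 'p set \<times> nat)) \<times> nat)"
  define \<rho> where "\<rho> e = \<chi> (\<kappa> ` e)" for e
  define c0 where "c0 e = (if e \<subseteq> range Inl then cD (Inl -` e) else \<rho> (\<pi>\<^sub>0 ` e))"
    for e :: "((('p + 'p set \<times> nat) + ('p + 'p set \<times> nat) set \<times> nat) + ((nat set \<times> ('p + 'p set \<times> nat)) \<times> nat)) set"
  \<comment> \<open>Pairs of two clones are left out: there the pattern keeps its own colours, and
    its monochromatic K_t's do not violate admissibility.\<close>
  define C where "C = {{x, y} | x y. x < N \<and> y \<in> {..<N} \<union> (\<lambda>u. N + idx u) ` VU \<and> x \<noteq> y}"
  have finC: "finite C"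
  proof (rule finite_subset)
    show "C \<subseteq> (\<lambda>(x, y). {x, y}) ` ({..<N} \<times> ({..<N} \<union> (\<lambda>u. N + idx u) ` VU))"
      by (force simp: C_def)
  qed (use finU in auto)
  have cardC: "card p = 2" if "p \<in> C" for p
    using that by (auto simp: C_def)
  have sN: "s < N"
    using s SN by auto
  have highC: "{N + x, N + y} \<notin> C" for x y
    by (auto simp: C_def doubleton_eq_iff)
  have \<kappa>N: "\<kappa> (N + n) = s" for n
    by (simp add: \<kappa>_def)
  have \<kappa>clone: "\<kappa> (clone u x) = x" if "x < N" for u x
    using that by (auto simp: \<kappa>_def clone_def)
  have cloneC: "{clone u x, clone u y} \<in> C" if "x < N" "y < N" "x \<noteq> y" "u \<in> VU" for u x y
  proof (cases "x = s")
    case True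
    then have "{clone u x, clone u y} = {y, N + idx u}"
      using that by (auto simp: clone_def)
    then show ?thesis
      using that unfolding C_def by fastforce
  next
    case False
    then have x: "clone u x = x"
      by (simp add: clone_def)
    have "clone u y \<in> {..<N} \<union> (\<lambda>u. N + idx u) ` VU" "x \<noteq> clone u y"
      using that by (auto simp: clone_def)
    then show ?thesis
      unfolding C_def x using that(1) by blast
  qed
  have E0_Inl: "\<exists>w'. q = Inl w' \<and> {w, w'} \<in> ED" if wq: "{Inl w, q} \<in> E0" for w q
  proof -
    have "{Inl w, q} \<noteq> {Inr r, Inr r'}" for r r'
      by auto
    then obtain e where e: "e \<in> ED" "{Inl w, q} = Inl ` e"
      using wq unfolding E0_def by blast
    have "q \<in> Inl ` e"
      unfolding e(2)[symmetric] by simp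
    then obtain w' where q: "q = Inl w'"
      by blast
    have "x \<in> e \<longleftrightarrow> Inl x \<in> {Inl w, q}" for x
      unfolding e(2) by auto
    then have "e = {w, w'}"
      using q by auto
    then show ?thesis
      using q e(1) by blast
  qed
  have E0_Inr: "p \<in> I \<and> k \<le> t \<and> (\<exists>l\<le>t. q = Inr (p, l) \<and> (hadj k l \<or> hadj l k))"
    if pq: "{Inr (p, k), q} \<in> E0" for p k q
  proof -
    have "{Inr (p, k), q} \<noteq> Inl ` e" for e
      by auto
    then obtain p' k' l' where p': "p' \<in> I" "hadj k' l'" "{Inr (p, k), q} = {Inr (p', k'), Inr (p', l')}"
      using pq unfolding E0_def by blast
    have "k' \<le> t" "l' \<le> t"
      using hadj_less[OF p'(2)] by auto
    moreover have "p = p' \<and> (k = k' \<and> q = Inr (p', l') \<or> k = l' \<and> q = Inr (p', k'))"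
      using p'(3) by (auto simp: doubleton_eq_iff)
    ultimately show ?thesis
      using p'(1,2) by blast
  qed
  have c0_Inl: "c0 {Inl x, Inl y} = cD {x, y}" for x y
    by (auto simp: c0_def intro!: arg_cong[where f = cD])
  have c0_Inr: "c0 {Inr p, q} = \<rho> {\<pi>\<^sub>0 (Inr p), \<pi>\<^sub>0 q}" for p q
    by (auto simp: c0_def)
  have D_edge: "labD x \<noteq> labD y \<and> ({labD x, labD y} \<in> C \<longrightarrow> cD {x, y} = \<rho> {labD x, labD y})"
    if xy: "{x, y} \<in> ED" for x y
  proof -
    have main: "labD (Inr (f, i)) \<noteq> labD q \<and>
      ({labD (Inr (f, i)), labD q} \<in> C \<longrightarrow> cD {Inr (f, i), q} = \<rho> {labD (Inr (f, i)), labD q})"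
      if fi: "{Inr (f, i), q} \<in> ED" for f i q
    proof -
      note e = attach_edge_Inr[OF fi[unfolded ED_def], of cU]
      obtain l where l: "q = gadget f l" "l \<le> t" "hadj l (i + 2) \<or> hadj (i + 2) l"
        using e by blast
      have f: "f \<in> X2" and "cD {Inr (f, i), q} = opposite (cU f)"
        using e by (auto simp: cD_def)
      then have col: "cD {Inr (f, i), q} = a\<^sub>0"
        using neq_opposite[of a\<^sub>0 "cU f"] by (auto simp: X2_def)
      have it: "i \<le> t - 2" "l \<noteq> i + 2"
        using l(3) by (auto dest!: hadj_less)
      have \<kappa>\<sigma>: "\<kappa> (\<sigma> j) = \<sigma> j" if "j \<le> t - 2" for j
        using \<sigma>S(3)[OF that] by (simp add: \<kappa>_def)
      show ?thesis
      proof (cases q)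
        case (Inl u)
        then have "labD q = N + idx u"
          by (simp add: labD_def)
        moreover have "\<rho> {\<sigma> i, N + idx u} = a\<^sub>0"
          using a\<^sub>0[OF \<sigma>S(1)[OF it(1)] s \<sigma>S(2)[OF it(1)]] \<kappa>\<sigma>[OF it(1)] \<kappa>N by (simp add: \<rho>_def)
        ultimately show ?thesis
          using \<sigma>S(3)[OF it(1)] col by (simp add: labD_def)
      next
        case (Inr gj)
        then have "q = Inr (f, l - 2)" "2 \<le> l"
          using l(1) by (auto simp: gadget_def split: if_splits)
        then have lab: "labD q = \<sigma> (l - 2)" and j: "l - 2 \<le> t - 2" "l - 2 \<noteq> i"
          using l(2) it(2) by (auto simp: labD_def)
        then have "\<sigma> i \<noteq> \<sigma> (l - 2)"
          using \<sigma>inj it(1) by metis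
        moreover from this have "\<rho> {\<sigma> i, \<sigma> (l - 2)} = a\<^sub>0"
          using a\<^sub>0[OF \<sigma>S(1)[OF it(1)] \<sigma>S(1)[OF j(1)]] \<kappa>\<sigma>[OF it(1)] \<kappa>\<sigma>[OF j(1)] by (simp add: \<rho>_def)
        ultimately show ?thesis
          using lab col by (simp add: labD_def)
      qed
    qed
    show ?thesis
    proof (cases x)
      case (Inr fi)
      then show ?thesis
        using main[of "fst fi" "snd fi" y] xy by simp
    next
      case x: (Inl u)
      show ?thesis
      proof (cases y)
        case (Inr fi)
        then show ?thesis
          using main[of "fst fi" "snd fi" x] xy by (simp add: insert_commute)
      next
        case (Inl v)
        then have "{u, v} \<in> EU"
          using xy x attach_edge_Inl unfolding ED_def by metis
        then have "{u, v} \<in> [VU]\<^bsup>2\<^esup>"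
          using EUV by blast
        then have "u \<in> VU" "v \<in> VU" "u \<noteq> v"
          unfolding doubleton_in_nsets_2 by blast+
        then show ?thesis
          using x Inl idx highC by (auto simp: labD_def inj_on_def)
      qed
    qed
  qed
  have \<tau>T: "\<tau> T (min k (t - 1)) \<in> T" if "T \<subseteq> {..<N}" "card T = t" for T k
    using bij_betwE[OF \<tau>[OF that]] t3 by simp
  have \<tau>neq: "\<tau> T (min k (t - 1)) \<noteq> \<tau> T (min l (t - 1))" if "T \<subseteq> {..<N}" "card T = t" "hadj k l \<or> hadj l k" for T k l
  proof -
    have "min k (t - 1) \<noteq> min l (t - 1)"
      using that(3) hadj_fold by (metis less_irrefl)
    then show ?thesis
      using bij_betw_imp_inj_on[OF \<tau>[OF that(1,2)]] t3 by (auto simp: inj_on_def)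
  qed
  have lift_edge: "\<pi>\<^sub>0 (Inr (p, k)) \<noteq> \<pi>\<^sub>0 q \<and> c0 {Inr (p, k), q} = \<rho> {\<pi>\<^sub>0 (Inr (p, k)), \<pi>\<^sub>0 q}"
    if e: "{Inr (p, k), q} \<in> E0" for p k q
  proof -
    obtain T u where p: "p = (T, u)"
      by (cases p)
    obtain l where l: "q = Inr (p, l)" "hadj k l \<or> hadj l k" and pI: "p \<in> I"
      using E0_Inr[OF e] by blast
    have T: "T \<subseteq> {..<N}" "card T = t"
      using pI p by (auto simp: I_def)
    have "\<tau> T (min k (t - 1)) < N" "\<tau> T (min l (t - 1)) < N"
      using \<tau>T[OF T] T(1) by auto
    then have "\<pi>\<^sub>0 (Inr (p, k)) \<noteq> \<pi>\<^sub>0 q"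
      using \<tau>neq[OF T l(2)] \<kappa>clone l(1) p unfolding \<pi>\<^sub>0_def by (simp) metis
    then show ?thesis
      using c0_Inr by simp
  qed
  \<comment> \<open>In a folded copy a monochromatic clique would have \<open>t\<close> distinct
    labels and make its \<open>T\<close> monochromatic under \<open>\<chi>\<close>. In the attached
    part \<open>KD\<close> keeps it off the second layer, so all its labels are clones.\<close>
  have K0: "\<exists>w. \<forall>k<t. m k = Inl (Inl (w k))" if m: "Kcopy E0 c0 a m" for a m
  proof (cases "m 0")
    case (Inl w0)
    have "\<exists>w. k < t \<longrightarrow> m k = Inl w" for k
    proof (cases "k = 0")
      case False
      then show ?thesis
        using Kcopy_edge[OF m, of 0 k] E0_Inl[of w0 "m k"] Inl by auto
    qed (use Inl in auto)
    then obtain w where w: "\<And>k. k < t \<Longrightarrow> m k = Inl (w k)"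
      by metis
    have "Kcopy ED cD a w"
      unfolding Kcopy_def
    proof (intro allI impI)
      fix k l assume "k < l" "l < t"
      then show "{w k, w l} \<in> ED \<and> cD {w k, w l} = a"
        using Kcopy_edge[OF m, of k l] w[of k] w[of l] E0_Inl[of "w k" "m l"] c0_Inl by auto
    qed
    then have "\<exists>v. k < t \<longrightarrow> w k = Inl v" for k
      using KD by blast
    then show ?thesis
      using w by metis
  next
    case (Inr pk)
    then obtain T u k0 where m0: "m 0 = Inr ((T, u), k0)"
      by (cases pk) auto
    have nb: "{Inr ((T, u), k0), m k} \<in> E0" if "k < t" "k \<noteq> 0" for k
      using Kcopy_edge[OF m, of 0 k] that m0 by simp
    have pI: "(T, u) \<in> I" and "k0 \<le> t"
      using E0_Inr[OF nb[of 1]] t3 by auto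
    then have "\<exists>r. k < t \<longrightarrow> m k = Inr ((T, u), r)" for k
      using E0_Inr[OF nb[of k]] m0 by (cases "k = 0") blast+
    then obtain r where r: "\<And>k. k < t \<Longrightarrow> m k = Inr ((T, u), r k)"
      by metis
    have T: "T \<subseteq> {..<N}" "card T = t" "T \<notin> mono_sets N \<chi>"
      using pI by (auto simp: I_def)
    define \<nu> where "\<nu> k = \<tau> T (min (r k) (t - 1))" for k
    have \<nu>T: "\<nu> k \<in> T" "\<nu> k < N" for k
      using \<tau>T[OF T(1,2)] T(1) by (auto simp: \<nu>_def)
    have e: "\<nu> k \<noteq> \<nu> l \<and> \<chi> {\<nu> k, \<nu> l} = a" if kl: "k < t" "l < t" "k \<noteq> l" for k l
    proof -
      have e0: "{Inr ((T, u), r k), Inr ((T, u), r l)} \<in> E0" "c0 {Inr ((T, u), r k), Inr ((T, u), r l)} = a"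
        using Kcopy_edge[OF m kl(3,1,2)] r kl by auto
      have "hadj (r k) (r l) \<or> hadj (r l) (r k)"
        using E0_Inr[OF e0(1)] by blast
      then have "\<nu> k \<noteq> \<nu> l"
        using \<tau>neq[OF T(1,2)] by (simp add: \<nu>_def)
      moreover have "\<rho> {clone u (\<nu> k), clone u (\<nu> l)} = a"
        using lift_edge[OF e0(1)] e0(2) by (simp add: \<pi>\<^sub>0_def \<nu>_def)
      ultimately show ?thesis
        using \<kappa>clone \<nu>T by (simp add: \<rho>_def)
    qed
    then have "inj_on \<nu> {..<t}"
      by (auto simp: inj_on_def)
    then have "card (\<nu> ` {..<t}) = card T"
      using T(2) by (simp add: card_image)
    moreover have "\<nu> ` {..<t} \<subseteq> T" "finite T"
      using \<nu>T finite_subset[OF T(1)] by auto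
    ultimately have "\<nu> ` {..<t} = T"
      using card_subset_eq by blast
    then have "\<forall>x\<in>T. \<forall>y\<in>T. x \<noteq> y \<longrightarrow> \<chi> {x, y} = a"
      using e by auto
    then have "T \<in> mono_sets N \<chi>"
      using T(1,2) by (auto simp: mono_sets_def)
    then show ?thesis
      using T(3) by simp
  qed
  have E0V0: "E0 \<subseteq> [V0]\<^bsup>2\<^esup>"
  proof
    fix e assume "e \<in> E0"
    then consider e' where "e' \<in> ED" "e = Inl ` e'"
      | p k l where "p \<in> I" "hadj k l" "e = {Inr (p, k), Inr (p, l)}"
      unfolding E0_def by blast
    then show "e \<in> [V0]\<^bsup>2\<^esup>"
    proof cases
      case 1
      then obtain x y where "e' = {x, y}" "x \<in> VD" "y \<in> VD" "x \<noteq> y"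
        using EDV by (auto elim!: nsets2_E)
      then show ?thesis
        using 1 by (auto simp: V0_def)
    next
      case 2
      then show ?thesis
        using hadj_less[OF 2(2)] by (auto simp: V0_def)
    qed
  qed
  have edge0: "\<pi>\<^sub>0 x \<noteq> \<pi>\<^sub>0 y \<and> ({\<pi>\<^sub>0 x, \<pi>\<^sub>0 y} \<in> C \<longrightarrow> c0 {x, y} = \<rho> {\<pi>\<^sub>0 x, \<pi>\<^sub>0 y})"
    if xy: "{x, y} \<in> E0" for x y
  proof (cases x)
    case (Inr pk)
    then show ?thesis
      using lift_edge[of "fst pk" "snd pk" y] xy by simp
  next
    case (Inl w)
    then obtain w' where "y = Inl w'" "{w, w'} \<in> ED"
      using E0_Inl xy by blast
    then show ?thesis
      using D_edge Inl c0_Inl by (simp add: \<pi>\<^sub>0_def)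
  qed
  have adm: "admissible C \<rho> V0 E0 \<pi>\<^sub>0 c0"
    unfolding admissible_def
  proof (intro conjI allI impI ballI)
    have "finite {T. T \<subseteq> {..<N} \<and> card T = t \<and> T \<notin> mono_sets N \<chi>}"
      by (rule finite_subset[of _ "Pow {..<N}"]) auto
    then show "finite V0"
      using finD finU by (simp add: V0_def I_def)
    show "E0 \<subseteq> [V0]\<^bsup>2\<^esup>"
      by (rule E0V0)
    show "\<pi>\<^sub>0 x \<noteq> \<pi>\<^sub>0 y" if "{x, y} \<in> E0" for x y
      using edge0[OF that] by blast
    show "c0 e = \<rho> (\<pi>\<^sub>0 ` e)" if e: "e \<in> E0" "\<pi>\<^sub>0 ` e \<in> C" for e
    proof -
      obtain x y where "e = {x, y}"
        using e(1) E0V0 by (auto elim!: nsets2_E)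
      then show ?thesis
        using edge0[of x y] e by simp
    qed
    show "\<not> Hcopy E0 c0 a m" for a m
    proof
      assume m: "Hcopy E0 c0 a m"
      obtain w where w: "\<And>k. k < t \<Longrightarrow> m k = Inl (Inl (w k))"
        using K0[OF Hcopy_Kcopy[OF m]] by blast
      \<comment> \<open>No edge of \<open>E0\<close> leaves the \<open>Inl\<close> part, so the apex
        lies there together with the clique.\<close>
      have "{m 0, m t} \<in> E0"
        using Hcopy_edge[OF m hadj_apex[of 0]] d_gt by simp
      then obtain z where z: "m t = Inl z"
        using E0_Inl[of "Inl (w 0)" "m t"] w[of 0] t3 by auto
      define v where "v = (\<lambda>k. if k = t then z else Inl (w k))"
      have v: "m k = Inl (v k)" if "k \<le> t" for k
        using that w z by (auto simp: v_def)
      have "Hcopy ED cD a v"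
      proof (rule HcopyI)
        show "inj_on v {..t}"
          using m v unfolding Hcopy_def inj_on_def by (metis atMost_iff)
        fix k l assume kl: "hadj k l"
        then have "m k = Inl (v k)" "m l = Inl (v l)"
          using hadj_less[OF kl] v by auto
        then show "{v k, v l} \<in> ED \<and> cD {v k, v l} = a"
          using Hcopy_edge[OF m kl] E0_Inl[of "v k" "m l"] c0_Inl by auto
      qed
      then show False
        using noHD by blast
    qed
    show "{\<pi>\<^sub>0 (m k), \<pi>\<^sub>0 (m l)} \<notin> C" if m: "Kcopy E0 c0 a m" and kl: "k < l" "l < t" for a m k l
    proof -
      obtain w where "\<And>k. k < t \<Longrightarrow> m k = Inl (Inl (w k))"
        using K0[OF m] by blast
      then show ?thesis
        using kl highC by (simp add: \<pi>\<^sub>0_def labD_def)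
    qed
  qed
  obtain V :: "nat set" and E \<pi> c where G: "admissible C \<rho> V E \<pi> c" "forcing C V0 E0 \<pi>\<^sub>0 V E \<pi>"
    using canonisation[OF adm finC cardC] by blast
  have "\<exists>\<phi>. inj_on \<phi> VP \<and> \<phi> ` VP \<subseteq> V \<and> (\<forall>e\<in>EP. \<phi> ` e \<in> E) \<and>
      ((\<forall>e\<in>EP. k (\<phi> ` e) = cP e) \<or> (\<forall>e\<in>EP. k (\<phi> ` e) = opposite (cP e)))"
    if noH: "\<And>a m. \<not> Hcopy E k a m" for k
  proof -
    obtain \<phi> \<chi>' where \<phi>: "inj_on \<phi> V0" "\<phi> ` V0 \<subseteq> V"
      "\<And>e. e \<in> E0 \<Longrightarrow> \<phi> ` e \<in> E"
      "\<And>e. e \<in> E0 \<Longrightarrow> \<pi>\<^sub>0 ` e \<in> C \<Longrightarrow> k (\<phi> ` e) = \<chi>' (\<pi>\<^sub>0 ` e)"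
      using G(2)[unfolded forcing_def, THEN spec, of k] by blast
    \<comment> \<open>A monochromatic \<open>T\<close> that is not one for \<open>\<chi>\<close>
      would make the folded copy at \<open>(T, u)\<close> a monochromatic H. Minimality of
      \<open>\<chi>\<close> turns the resulting inclusion into equality.\<close>
    have mono: "mono_sets N (\<lambda>e. \<chi>' (clone u ` e)) = mono_sets N \<chi>" if u: "u \<in> VU" for u
    proof (rule least, rule subsetI, rule ccontr)
      fix T
      assume T: "T \<in> mono_sets N (\<lambda>e. \<chi>' (clone u ` e))" "T \<notin> mono_sets N \<chi>"
      then have TN: "T \<subseteq> {..<N}" "card T = t"
        by (auto simp: mono_sets_def)
      obtain a where a: "\<And>x y. x \<in> T \<Longrightarrow> y \<in> T \<Longrightarrow> x \<noteq> y \<Longrightarrow> \<chi>' {clone u x, clone u y} = a"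
        using mono_setsE[OF T(1)] by (metis image_empty image_insert)
      have pI: "(T, u) \<in> I"
        using T(2) TN u by (simp add: I_def)
      have "Hcopy E k a (\<lambda>i. \<phi> (Inr ((T, u), i)))"
      proof (rule HcopyI)
        show "inj_on (\<lambda>i. \<phi> (Inr ((T, u), i))) {..t}"
          using \<phi>(1) pI by (auto simp: inj_on_def V0_def)
        fix i j assume ij: "hadj i j"
        then have e: "{Inr ((T, u), i), Inr ((T, u), j)} \<in> E0"
          using pI by (auto simp: E0_def)
        define x where "x = \<tau> T (min i (t - 1))"
        define y where "y = \<tau> T (min j (t - 1))"
        have xy: "x \<in> T" "y \<in> T" "x \<noteq> y"
          using \<tau>T[OF TN] \<tau>neq[OF TN, of i j] ij by (auto simp: x_def y_def)
        have lab: "\<pi>\<^sub>0 ` {Inr ((T, u), i), Inr ((T, u), j)} = {clone u x, clone u y}"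
          by (simp add: \<pi>\<^sub>0_def x_def y_def)
        have "{clone u x, clone u y} \<in> C"
          using cloneC[of x y u] xy TN(1) u by auto
        then show "{\<phi> (Inr ((T, u), i)), \<phi> (Inr ((T, u), j))} \<in> E \<and>
            k {\<phi> (Inr ((T, u), i)), \<phi> (Inr ((T, u), j))} = a"
          using \<phi>(3)[OF e] \<phi>(4)[OF e] lab a[OF xy] by simp
      qed
      then show False
        using noH by blast
    qed
    \<comment> \<open>Neither label is \<open>s\<close>, so this pair belongs to every cloned
      \<open>S\<close>; the forced colour is thus the same for all clones.\<close>
    define b where "b = \<chi>' {\<sigma> 0, \<sigma> 1}"
    have \<sigma>01: "\<sigma> 0 \<in> S" "\<sigma> 1 \<in> S" "\<sigma> 0 \<noteq> \<sigma> 1" "\<sigma> 0 \<noteq> s" "\<sigma> 1 \<noteq> s"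
      using \<sigma>S[of 0] \<sigma>S[of 1] \<sigma>inj[of 0 1] t3 by auto
    have clone_b: "\<chi>' {clone u x, clone u y} = b" if u: "u \<in> VU" and xy: "x \<in> S" "y \<in> S" "x \<noteq> y" for u x y
    proof -
      have Su: "S \<in> mono_sets N (\<lambda>e. \<chi>' (clone u ` e))"
        using S mono[OF u] by simp
      obtain b' where b': "\<And>x y. x \<in> S \<Longrightarrow> y \<in> S \<Longrightarrow> x \<noteq> y \<Longrightarrow> \<chi>' {clone u x, clone u y} = b'"
        using mono_setsE[OF Su] by (metis image_empty image_insert)
      have "b = b'"
        using b'[OF \<sigma>01(1-3)] \<sigma>01(4,5) by (simp add: b_def clone_def)
      then show ?thesis
        using b'[OF xy] by simp
    qed
    define \<psi> where "\<psi> w = \<phi> (Inl (Inl w))" for w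
    have \<psi>E: "\<psi> ` e \<in> E" if "e \<in> EU" for e
    proof -
      have "Inl ` Inl ` e \<in> E0"
        using that by (auto simp: E0_def ED_def attach_edges_def)
      from \<phi>(3)[OF this] show ?thesis
        by (simp add: \<psi>_def image_image)
    qed
    have VU0: "Inl (Inl w) \<in> V0" if "w \<in> VU" for w
      using that by (auto simp: V0_def VD_def attach_verts_def)
    have \<psi>inj: "inj_on \<psi> VU"
      using \<phi>(1) VU0 by (auto simp: \<psi>_def inj_on_def)
    \<comment> \<open>All other edges of the gadget on \<open>f\<close> have the forced colour
      \<open>b\<close>, so \<open>f\<close> has to break the copy.\<close>
    have layer2: "k (\<psi> ` f) \<noteq> b" if f: "f \<in> X2" for f
    proof
      assume fb: "k (\<psi> ` f) = b"
      have f2: "f \<in> [VU]\<^bsup>2\<^esup>"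
        using f X2 EUV by blast
      have f_ends: "fst (ends f) \<in> VU" "f = {fst (ends f), snd (ends f)}" "snd (ends f) \<in> VU"
        using ends(1)[OF f2] f2 by (metis doubleton_in_nsets_2)+
      obtain u\<^sub>0 where u\<^sub>0: "u\<^sub>0 \<in> VU"
        using f_ends(1) by blast
      have "Hcopy E k b (\<lambda>i. \<phi> (Inl (gadget f i)))"
      proof (rule HcopyI)
        show "inj_on (\<lambda>i. \<phi> (Inl (gadget f i))) {..t}"
        proof (rule inj_onI)
          fix i j assume ij: "i \<in> {..t}" "j \<in> {..t}" "\<phi> (Inl (gadget f i)) = \<phi> (Inl (gadget f j))"
          then have "gadget f i \<in> VD" "gadget f j \<in> VD"
            using gadget_in_verts[OF EUV X2 f] by (auto simp: VD_def)
          then have "gadget f i = gadget f j"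
            using \<phi>(1) ij(3) by (auto simp: inj_on_def V0_def)
          then show "i = j"
            using gadget_inj[OF f2] by blast
        qed
        fix i j assume ij: "hadj i j"
        have "{gadget f i, gadget f j} \<in> ED"
          using gadget_edge[OF EUV X2 f ij] by (simp add: ED_def)
        then have "Inl ` {gadget f i, gadget f j} \<in> E0"
          unfolding E0_def by blast
        then have e: "{Inl (gadget f i), Inl (gadget f j)} \<in> E0"
          by simp
        have "k {\<phi> (Inl (gadget f i)), \<phi> (Inl (gadget f j))} = b"
        proof (cases "1 < j")
          case False
          then have "i = 0" "j = 1"
            using hadj_less[OF ij] by auto
          then have "{\<phi> (Inl (gadget f i)), \<phi> (Inl (gadget f j))} = \<psi> ` {fst (ends f), snd (ends f)}"
            by (simp add: gadget_def \<psi>_def)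
          then show ?thesis
            using fb f_ends(2) by simp
        next
          case True
          have j: "labD (gadget f j) = \<sigma> (j - 2)" "j - 2 \<le> t - 2"
            using True hadj_less[OF ij] by (auto simp: gadget_def labD_def)
          note jS = \<sigma>S[OF j(2)]
          \<comment> \<open>The clone is the one at the other end if there is one. Otherwise
            \<open>u\<^sub>0\<close> serves, since \<open>clone\<close> moves only
            \<open>s\<close>.\<close>
          have "\<exists>u\<in>VU. \<exists>x\<in>S. x \<noteq> \<sigma> (j - 2) \<and> labD (gadget f i) = clone u x"
          proof (cases "1 < i")
            case True
            then have i: "labD (gadget f i) = \<sigma> (i - 2)" "i - 2 \<le> t - 2" "i - 2 \<noteq> j - 2"
              using hadj_less[OF ij] by (auto simp: gadget_def labD_def)
            then show ?thesis
              using u\<^sub>0 \<sigma>S[OF i(2)] \<sigma>inj[OF i(2) j(2)]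
              by (intro bexI[of _ u\<^sub>0] bexI[of _ "\<sigma> (i - 2)"]) (auto simp: clone_def)
          next
            case False
            then obtain u where "u \<in> VU" "gadget f i = Inl u"
              using f_ends by (cases "i = 0") (auto simp: gadget_def)
            then show ?thesis
              using s jS(2) by (intro bexI[of _ u] bexI[of _ s]) (auto simp: clone_def labD_def)
          qed
          then obtain u x where ux: "u \<in> VU" "x \<in> S" "x \<noteq> \<sigma> (j - 2)" "labD (gadget f i) = clone u x"
            by blast
          have lab: "\<pi>\<^sub>0 ` {Inl (gadget f i), Inl (gadget f j)} = {clone u x, clone u (\<sigma> (j - 2))}"
            using ux(4) j(1) jS(2) by (simp add: \<pi>\<^sub>0_def clone_def)
          have "{clone u x, clone u (\<sigma> (j - 2))} \<in> C"
            using cloneC[OF _ jS(3) ux(3,1)] ux(2) SN by auto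
          then show ?thesis
            using \<phi>(4)[OF e] lab clone_b[OF ux(1,2) jS(1) ux(3)] by simp
        qed
        then show "{\<phi> (Inl (gadget f i)), \<phi> (Inl (gadget f j))} \<in> E \<and>
            k {\<phi> (Inl (gadget f i)), \<phi> (Inl (gadget f j))} = b"
          using \<phi>(3)[OF e] by simp
      qed
      then show False
        using noH by blast
    qed
    \<comment> \<open>The other edges of the gadget on \<open>e\<close> lie in \<open>X2\<close>, so
      \<open>layer2\<close> gives them the colour opposite to \<open>b\<close>, and \<open>e\<close>
      has to break the copy.\<close>
    have layer1: "k (\<psi> ` Inl ` e) = b" if e: "e \<in> X1" for e
    proof (rule ccontr)
      assume "k (\<psi> ` Inl ` e) \<noteq> b"
      then have eb: "k (\<psi> ` Inl ` e) = opposite b"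
        by (simp add: neq_opposite)
      have e2: "e \<in> [VP]\<^bsup>2\<^esup>"
        using e X1 EP by blast
      have "Hcopy E k (opposite b) (\<lambda>i. \<psi> (gadget e i))"
      proof (rule HcopyI)
        show "inj_on (\<lambda>i. \<psi> (gadget e i)) {..t}"
        proof (rule inj_onI)
          fix i j assume ij: "i \<in> {..t}" "j \<in> {..t}" "\<psi> (gadget e i) = \<psi> (gadget e j)"
          then have "gadget e i \<in> VU" "gadget e j \<in> VU"
            using gadget_in_verts[OF EP X1 e] by (auto simp: VU_def)
          then have "gadget e i = gadget e j"
            using \<psi>inj ij(3) by (auto simp: inj_on_def)
          then show "i = j"
            using gadget_inj[OF e2] by blast
        qed
        fix i j assume ij: "hadj i j"
        have E: "{gadget e i, gadget e j} \<in> EU"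
          using gadget_edge[OF EP X1 e ij] by (simp add: EU_def)
        have "k (\<psi> ` {gadget e i, gadget e j}) = opposite b"
        proof (cases "1 < j")
          case True
          then have "cU {gadget e i, gadget e j} = opposite a\<^sub>0"
            using attach_colour_gadget[OF True, of cP e i] e by (simp add: cU_def X1_def)
          then have "{gadget e i, gadget e j} \<in> X2"
            using E by (simp add: X2_def)
          then show ?thesis
            using layer2 neq_opposite by blast
        next
          case False
          then have "i = 0" "j = 1"
            using hadj_less[OF ij] by auto
          then have "{gadget e i, gadget e j} = Inl ` {fst (ends e), snd (ends e)}"
            by (simp add: gadget_def)
          then show ?thesis
            using eb ends(1)[OF e2] by metis
        qed
        then show "{\<psi> (gadget e i), \<psi> (gadget e j)} \<in> E \<and> k {\<psi> (gadget e i), \<psi> (gadget e j)} = opposite b"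
          using \<psi>E[OF E] by simp
      qed
      then show False
        using noH by blast
    qed
    have other: "k (\<psi> ` Inl ` e) \<noteq> b" if "e \<in> EP" "cP e \<noteq> a\<^sub>0" for e
      using layer2[of "Inl ` e"] that by (simp add: X2_def EU_def cU_def attach_edges_def)
    have col: "k (\<psi> ` Inl ` e) = b \<longleftrightarrow> cP e = a\<^sub>0" if "e \<in> EP" for e
      using layer1[of e] other[of e] that by (auto simp: X1_def)
    show ?thesis
    proof (intro exI[of _ "\<psi> \<circ> Inl"] conjI)
      have VPU: "Inl ` VP \<subseteq> VU"
        by (auto simp: VU_def attach_verts_def)
      show "inj_on (\<psi> \<circ> Inl) VP"
        using \<psi>inj VPU by (intro comp_inj_on) (auto intro: inj_on_subset)
      show "(\<psi> \<circ> Inl) ` VP \<subseteq> V"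
        using VPU VU0 \<phi>(2) by (auto simp: \<psi>_def)
      show "\<forall>e\<in>EP. (\<psi> \<circ> Inl) ` e \<in> E"
        unfolding image_comp[symmetric] using \<psi>E by (simp add: EU_def attach_edges_def)
      show "(\<forall>e\<in>EP. k ((\<psi> \<circ> Inl) ` e) = cP e) \<or> (\<forall>e\<in>EP. k ((\<psi> \<circ> Inl) ` e) = opposite (cP e))"
        unfolding image_comp[symmetric]
      \<comment> \<open>The forced colour \<open>b\<close> may differ from \<open>a\<^sub>0\<close>;
        this is the only source of the colour swap.\<close>
      proof (cases "b = a\<^sub>0")
        case True
        then have "k (\<psi> ` Inl ` e) = cP e" if "e \<in> EP" for e
          using col[OF that] colour_neq_trans[of "k (\<psi> ` Inl ` e)" b "cP e"] True
          by (cases "cP e = a\<^sub>0") auto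
        then show "(\<forall>e\<in>EP. k (\<psi> ` Inl ` e) = cP e) \<or> (\<forall>e\<in>EP. k (\<psi> ` Inl ` e) = opposite (cP e))"
          by blast
      next
        case False
        then have "k (\<psi> ` Inl ` e) \<noteq> cP e" if "e \<in> EP" for e
          using col[OF that] colour_neq_trans[of b a\<^sub>0 "k (\<psi> ` Inl ` e)"] by metis
        then show "(\<forall>e\<in>EP. k (\<psi> ` Inl ` e) = cP e) \<or> (\<forall>e\<in>EP. k (\<psi> ` Inl ` e) = opposite (cP e))"
          by (simp add: neq_opposite)
      qed
    qed
  qed
  moreover have "finite V" "E \<subseteq> [V]\<^bsup>2\<^esup>" "\<forall>a m. \<not> Hcopy E c a m"
    using G(1) by (auto simp: admissible_def)
  ultimately show ?thesis
    by blast
qed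

end

subsection \<open>The grid pattern and the upper bound\<close>

context almost_clique
begin

definition grid :: "(nat \<times> nat) set" where
  "grid = {..<d} \<times> {..<d}"

definition grid_colour :: "(nat \<times> nat) set \<Rightarrow> colour" where
  "grid_colour e = (if card (fst ` e) = 1 then Red else Blue)"

definition grid_mono :: "colour \<Rightarrow> (nat \<times> nat) set \<Rightarrow> bool" where
  "grid_mono a Z \<longleftrightarrow> Z \<subseteq> grid \<and> (\<forall>x\<in>Z. \<forall>y\<in>Z. x \<noteq> y \<longrightarrow> grid_colour {x, y} = a)"

text \<open>The pattern is the complete graph on the \<open>d \<times> d\<close> grid, rows red and all other edges blue, where each
  monochromatic \<open>d\<close>-set is extended by \<open>t - d\<close> private vertices to a monochromatic \<open>K\<^sub>t\<close>. Any way to colour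
  the edges from a new vertex to the grid completes a copy of \<open>H\<close>.\<close>

definition rich :: "((nat \<times> nat) set \<times> colour) set" where
  "rich = {(Z, a). grid_mono a Z \<and> card Z = d}"

fun pattern_adj :: "'g + ('g set \<times> 'c) \<times> nat \<Rightarrow> 'g + ('g set \<times> 'c) \<times> nat \<Rightarrow> bool" where
  "pattern_adj (Inl x) (Inl y) \<longleftrightarrow> True"
| "pattern_adj (Inl x) (Inr ((Z, a), k)) \<longleftrightarrow> x \<in> Z"
| "pattern_adj (Inr ((Z, a), k)) (Inl x) \<longleftrightarrow> x \<in> Z"
| "pattern_adj (Inr (p, k)) (Inr (q, l)) \<longleftrightarrow> p = q"

definition pattern_verts :: "(nat \<times> nat + ((nat \<times> nat) set \<times> colour) \<times> nat) set" where
  "pattern_verts = Inl ` grid \<union> Inr ` (rich \<times> {..<t - d})"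

definition pattern_edges :: "(nat \<times> nat + ((nat \<times> nat) set \<times> colour) \<times> nat) set set" where
  "pattern_edges = {{p, q} | p q. p \<in> pattern_verts \<and> q \<in> pattern_verts \<and> p \<noteq> q \<and> pattern_adj p q}"

text \<open>Adjacent private vertices belong to the same pair \<open>(Z, a)\<close>, so on edges the
  chosen \<open>a\<close> is unambiguous.\<close>

definition pattern_colour :: "(nat \<times> nat + ((nat \<times> nat) set \<times> colour) \<times> nat) set \<Rightarrow> colour" where
  "pattern_colour e = (if e \<subseteq> range Inl then grid_colour (Inl -` e) else SOME a. \<exists>Z k. Inr ((Z, a), k) \<in> e)"

lemma pattern_adj_sym: "pattern_adj p q \<longleftrightarrow> pattern_adj q p"
  by (induction p q rule: pattern_adj.induct) auto

lemma pattern_edge_iff: "{p, q} \<in> pattern_edges \<longleftrightarrow>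
    p \<in> pattern_verts \<and> q \<in> pattern_verts \<and> p \<noteq> q \<and> pattern_adj p q"
proof
  assume "{p, q} \<in> pattern_edges"
  then obtain p' q' where "{p, q} = {p', q'}" "p' \<in> pattern_verts" "q' \<in> pattern_verts" "p' \<noteq> q'" "pattern_adj p' q'"
    unfolding pattern_edges_def by blast
  then show "p \<in> pattern_verts \<and> q \<in> pattern_verts \<and> p \<noteq> q \<and> pattern_adj p q"
    using pattern_adj_sym by (auto simp: doubleton_eq_iff)
qed (auto simp: pattern_edges_def)

lemma pattern_edges_nsets: "pattern_edges \<subseteq> [pattern_verts]\<^bsup>2\<^esup>"
  by (auto simp: pattern_edges_def)

lemma finite_grid [simp]: "finite grid"
  by (simp add: grid_def)

lemma finite_pattern_verts: "finite pattern_verts"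
proof -
  have "rich \<subseteq> Pow grid \<times> {Red, Blue}"
    using UNIV_colour by (auto simp: rich_def grid_mono_def)
  then have "finite rich"
    by (rule finite_subset) simp
  then show ?thesis
    by (simp add: pattern_verts_def)
qed

lemma pattern_colour_Inl: "pattern_colour {Inl x, Inl y} = grid_colour {x, y}"
  by (auto simp: pattern_colour_def intro!: arg_cong[where f = grid_colour])

lemma pattern_colour_Inr:
  assumes "pattern_adj (Inr ((Z, a), k)) q"
  shows "pattern_colour {Inr ((Z, a), k), q} = a"
proof -
  have "(SOME b. \<exists>Z' k'. Inr ((Z', b), k') \<in> {Inr ((Z, a), k), q}) = a"
  proof (rule some_equality)
    show "\<exists>Z' k'. Inr ((Z', a), k') \<in> {Inr ((Z, a), k), q}"
      by blast
    fix b assume "\<exists>Z' k'. Inr ((Z', b), k') \<in> {Inr ((Z, a), k), q}"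
    then show "b = a"
      using assms by auto
  qed
  moreover have "\<not> {Inr ((Z, a), k), q} \<subseteq> range Inl"
    by auto
  ultimately show ?thesis
    unfolding pattern_colour_def by (simp only: if_False)
qed

lemma grid_colour_pair: "x \<noteq> y \<Longrightarrow> grid_colour {x, y} = Red \<longleftrightarrow> fst x = fst y"
  by (auto simp: grid_colour_def card_insert_if)

text \<open>A red set lies in a single row, and a blue set meets each row at most once.\<close>

lemma grid_mono_card:
  assumes "grid_mono a Z"
  shows "card Z \<le> d"
proof -
  have Z: "Z \<subseteq> grid" and col: "\<And>x y. x \<in> Z \<Longrightarrow> y \<in> Z \<Longrightarrow> x \<noteq> y \<Longrightarrow> grid_colour {x, y} = a"
    using assms by (auto simp: grid_mono_def)
  show ?thesis
  proof (cases a)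
    case Red
    then have "inj_on snd Z"
      using col grid_colour_pair by (metis inj_onI prod_eq_iff)
    then have "card Z \<le> card {..<d}"
      using Z by (intro card_inj_on_le[of snd]) (auto simp: grid_def)
    then show ?thesis
      by simp
  next
    case Blue
    then have "inj_on fst Z"
      using col grid_colour_pair by (metis inj_onI colour.distinct(1))
    then have "card Z \<le> card {..<d}"
      using Z by (intro card_inj_on_le[of fst]) (auto simp: grid_def)
    then show ?thesis
      by simp
  qed
qed

text \<open>Either some row is entirely red, or every row has a blue point and these points form a
  blue transversal.\<close>

lemma grid_forcing:
  obtains Z a where "(Z, a) \<in> rich" "\<And>x. x \<in> Z \<Longrightarrow> \<kappa> x = a"
proof (cases "\<exists>i<d. \<forall>j<d. \<kappa> (i, j) = Red")
  case True
  then obtain i where i: "i < d" "\<And>j. j < d \<Longrightarrow> \<kappa> (i, j) = Red"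
    by blast
  show thesis
  proof (rule that)
    show "({i} \<times> {..<d}, Red) \<in> rich"
      using i(1) grid_colour_pair by (auto simp: rich_def grid_mono_def grid_def)
    show "\<kappa> x = Red" if "x \<in> {i} \<times> {..<d}" for x
      using that i(2) by auto
  qed
next
  case False
  then have "\<exists>j. i < d \<longrightarrow> j < d \<and> \<kappa> (i, j) \<noteq> Red" for i
    by blast
  then obtain j where j: "\<And>i. i < d \<Longrightarrow> j i < d \<and> \<kappa> (i, j i) \<noteq> Red"
    by metis
  show thesis
  proof (rule that)
    have "grid_colour {(i, j i), (i', j i')} = Blue" if "i \<noteq> i'" for i i'
      using that grid_colour_pair[of "(i, j i)" "(i', j i')"] neq_opposite[of _ Red] by simp
    moreover have "card ((\<lambda>i. (i, j i)) ` {..<d}) = d"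
      by (subst card_image) (auto simp: inj_on_def)
    ultimately show "((\<lambda>i. (i, j i)) ` {..<d}, Blue) \<in> rich"
      using j by (auto simp: rich_def grid_mono_def grid_def)
    show "\<kappa> x = Blue" if "x \<in> (\<lambda>i. (i, j i)) ` {..<d}" for x
      using that j neq_opposite[of _ Red] by auto
  qed
qed

text \<open>A monochromatic K_t exceeds d, so it has a private vertex of some \<open>(Z, a)\<close>,
  whose closed neighbourhood \<open>Q\<close> has exactly \<open>t\<close> vertices and hence is the
  K_t. An apex outside \<open>Q\<close> is adjacent to no private vertex of \<open>Q\<close>, so its
  neighbours are all of \<open>Z\<close>. A grid point there would give a monochromatic set of size
  d + 1, and a private vertex would belong to \<open>(Z, a)\<close> itself.\<close>

lemma pattern_no_Hcopy: "\<not> Hcopy pattern_edges pattern_colour a m"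
proof
  assume m: "Hcopy pattern_edges pattern_colour a m"
  have inj: "inj_on m {..t}"
    using m by (simp add: Hcopy_def)
  have K: "m k \<in> pattern_verts \<and> m l \<in> pattern_verts \<and> pattern_adj (m k) (m l) \<and> pattern_colour {m k, m l} = a"
    if "k < t" "l < t" "k \<noteq> l" for k l
    using Kcopy_edge[OF Hcopy_Kcopy[OF m] that(3,1,2)] by (simp add: pattern_edge_iff)
  have apex: "m t \<in> pattern_verts \<and> pattern_adj (m t) (m k) \<and> pattern_colour {m t, m k} = a" if "k < d" for k
    using Hcopy_edge[OF m hadj_apex[OF that]] pattern_edge_iff[of "m k" "m t"] pattern_adj_sym[of "m t" "m k"]
    by (simp add: insert_commute)
  have "\<exists>k<t. m k \<notin> range Inl"
  proof (rule ccontr)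
    assume "\<not> ?thesis"
    then have "\<exists>x. k < t \<longrightarrow> m k = Inl x" for k
      by blast
    then obtain w where w: "\<And>k. k < t \<Longrightarrow> m k = Inl (w k)"
      by metis
    have w_inj: "inj_on w {..<t}"
    proof (rule inj_onI)
      fix k l assume "k \<in> {..<t}" "l \<in> {..<t}" "w k = w l"
      then show "k = l"
        using inj w[of k] w[of l] by (auto simp: inj_on_def)
    qed
    have "w k \<in> grid" if k: "k < t" for k
    proof -
      have "\<exists>l<t. k \<noteq> l"
        using d_gt t_gt by (intro exI[of _ "if k = 0 then 1 else 0"]) auto
      then obtain l where "l < t" "k \<noteq> l"
        by blast
      then show ?thesis
        using K[OF k] w[OF k] by (auto simp: pattern_verts_def)
    qed
    moreover have "grid_colour {w k, w l} = a" if "k < t" "l < t" "k \<noteq> l" for k l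
      using K[OF that] w that pattern_colour_Inl by metis
    ultimately have "grid_mono a (w ` {..<t})"
      by (auto simp: grid_mono_def)
    then show False
      using grid_mono_card[of a "w ` {..<t}"] card_image[OF w_inj] t_gt by simp
  qed
  then obtain k\<^sub>0 where k\<^sub>0t: "k\<^sub>0 < t" "m k\<^sub>0 \<notin> range Inl"
    by blast
  then obtain Z b i where "m k\<^sub>0 = Inr ((Z, b), i)"
    by (cases "m k\<^sub>0") auto
  note k\<^sub>0 = k\<^sub>0t(1) this
  have "\<exists>l<t. l \<noteq> k\<^sub>0"
    using d_gt t_gt by (intro exI[of _ "if k\<^sub>0 = 0 then 1 else 0"]) auto
  then obtain l\<^sub>0 where l\<^sub>0: "l\<^sub>0 < t" "l\<^sub>0 \<noteq> k\<^sub>0"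
    by blast
  have rich: "(Z, b) \<in> rich"
    using K[OF k\<^sub>0(1) l\<^sub>0(1)] l\<^sub>0(2) k\<^sub>0(2) by (auto simp: pattern_verts_def)
  have ba: "b = a"
    using K[OF k\<^sub>0(1) l\<^sub>0(1)] l\<^sub>0(2) k\<^sub>0(2) pattern_colour_Inr by metis
  have cardZ: "card Z = d" and Zgrid: "Z \<subseteq> grid"
    and Zmono: "\<And>x y. x \<in> Z \<Longrightarrow> y \<in> Z \<Longrightarrow> x \<noteq> y \<Longrightarrow> grid_colour {x, y} = a"
    using rich ba by (auto simp: rich_def grid_mono_def)
  have finZ: "finite Z"
    using Zgrid finite_subset finite_grid by blast
  define Q :: "(nat \<times> nat + ((nat \<times> nat) set \<times> colour) \<times> nat) set"
    where "Q = Inl ` Z \<union> Inr ` ({(Z, b)} \<times> {..<t - d})"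
  have finQ: "finite Q"
    using finZ by (simp add: Q_def)
  have cardQ: "card Q = t"
  proof -
    have "card Q = card (Inl ` Z :: (nat \<times> nat + ((nat \<times> nat) set \<times> colour) \<times> nat) set)
        + card (Inr ` ({(Z, b)} \<times> {..<t - d}) :: (nat \<times> nat + ((nat \<times> nat) set \<times> colour) \<times> nat) set)"
      unfolding Q_def using finZ by (intro card_Un_disjoint) auto
    then show ?thesis
      using cardZ t_gt by (simp add: card_image card_cartesian_product)
  qed
  have mQ: "m k \<in> Q" if k: "k < t" for k
  proof (cases "k = k\<^sub>0")
    case True
    then show ?thesis
      using k\<^sub>0(2) K[OF k\<^sub>0(1) l\<^sub>0(1)] l\<^sub>0(2) by (auto simp: Q_def pattern_verts_def)
  next
    case False
    then have "pattern_adj (Inr ((Z, b), i)) (m k)" "m k \<in> pattern_verts"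
      using K[OF k\<^sub>0(1) k] k\<^sub>0(2) by auto
    then show ?thesis
      by (cases "m k") (auto simp: Q_def pattern_verts_def)
  qed
  have "inj_on m {..<t}"
    using inj by (rule inj_on_subset) auto
  then have "card (m ` {..<t}) = card Q"
    using cardQ by (simp add: card_image)
  then have imgQ: "m ` {..<t} = Q"
    using mQ finQ by (intro card_subset_eq) auto
  have wQ: "m t \<notin> Q"
  proof
    assume "m t \<in> Q"
    then obtain k where "k < t" "m t = m k"
      using imgQ by auto
    then show False
      using inj_onD[OF inj, of t k] by simp
  qed
  have "\<exists>x\<in>Z. m k = Inl x" if k: "k < d" for k
  proof (rule ccontr)
    assume "\<not> ?thesis"
    then obtain j where "m k = Inr ((Z, b), j)"
      using mQ[of k] k t_gt by (auto simp: Q_def)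
    then have "pattern_adj (m t) (Inr ((Z, b), j))" "m t \<in> pattern_verts"
      using apex[OF k] by auto
    then have "m t \<in> Q"
      by (cases "m t") (auto simp: Q_def pattern_verts_def)
    then show False
      using wQ by simp
  qed
  then obtain z where z: "\<And>k. k < d \<Longrightarrow> z k \<in> Z \<and> m k = Inl (z k)"
    by metis
  have "inj_on z {..<d}"
  proof (rule inj_onI)
    fix k l assume kl: "k \<in> {..<d}" "l \<in> {..<d}" "z k = z l"
    then have "m k = m l"
      using z[of k] z[of l] by simp
    then show "k = l"
      using inj kl t_gt by (auto simp: inj_on_def)
  qed
  then have "card (z ` {..<d}) = card Z"
    using cardZ by (simp add: card_image)
  then have imgZ: "z ` {..<d} = Z"
    using z finZ by (intro card_subset_eq) auto
  have nb: "pattern_adj (m t) (Inl x)" "pattern_colour {m t, Inl x} = a" if x: "x \<in> Z" for x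
  proof -
    obtain k where "k < d" "x = z k"
      using x imgZ by auto
    then show "pattern_adj (m t) (Inl x)" "pattern_colour {m t, Inl x} = a"
      using apex[of k] z[of k] by auto
  qed
  show False
  proof (cases "m t")
    case (Inl y)
    then have y: "y \<notin> Z" "y \<in> grid"
      using wQ apex[of 0] d_gt by (auto simp: Q_def pattern_verts_def)
    have "grid_colour {y, x} = a" if "x \<in> Z" for x
      using nb(2)[OF that] Inl pattern_colour_Inl by metis
    then have "grid_mono a (insert y Z)"
      using Zmono Zgrid y by (auto simp: grid_mono_def insert_commute)
    then show False
      using grid_mono_card[of a "insert y Z"] y finZ cardZ by simp
  next
    case (Inr p)
    then obtain Z' b' j where w: "m t = Inr ((Z', b'), j)"
      by (metis surj_pair)
    have "Z \<noteq> {}"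
      using cardZ d_gt by auto
    then obtain x where "x \<in> Z"
      by blast
    then have "b' = a"
      using nb w pattern_colour_Inr by metis
    have "(Z', b') \<in> rich" "j < t - d"
      using w apex[of 0] d_gt by (auto simp: pattern_verts_def)
    then have "card Z' = card Z" "finite Z'"
      using cardZ finite_subset[OF _ finite_grid] by (auto simp: rich_def grid_mono_def)
    moreover have "Z \<subseteq> Z'"
      using nb(1) w by auto
    ultimately have "Z' = Z"
      using card_subset_eq by metis
    then have "m t \<in> Q"
      using w \<open>b' = a\<close> ba \<open>j < t - d\<close> by (auto simp: Q_def)
    then show False
      using wQ by simp
  qed
qed

text \<open>The pattern colour \<open>a\<close> and the actual colour \<open>b\<close> are kept
  apart to cover the swapped pattern too. The points of \<open>Z\<close> are listed first, as the
  apex of H is adjacent to \<open>0\<close>, ..., \<open>d - 1\<close>.\<close>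

lemma Hcopy_through_pattern:
  assumes \<phi>: "inj_on \<phi> pattern_verts" "w \<notin> \<phi> ` pattern_verts"
    and E: "\<And>e. e \<in> pattern_edges \<Longrightarrow> \<phi> ` e \<in> E" "\<And>x. x \<in> grid \<Longrightarrow> {w, \<phi> (Inl x)} \<in> E"
    and Z: "(Z, a) \<in> rich"
    and col: "\<And>e. e \<in> pattern_edges \<Longrightarrow> pattern_colour e = a \<Longrightarrow> k (\<phi> ` e) = b"
      "\<And>x. x \<in> Z \<Longrightarrow> k {w, \<phi> (Inl x)} = b"
  shows "\<exists>m. Hcopy E k b m"
proof -
  have cardZ: "card Z = d" and Zgrid: "Z \<subseteq> grid"
    and Zmono: "\<And>x y. x \<in> Z \<Longrightarrow> y \<in> Z \<Longrightarrow> x \<noteq> y \<Longrightarrow> grid_colour {x, y} = a"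
    using Z by (auto simp: rich_def grid_mono_def)
  have "finite Z"
    using Zgrid finite_subset finite_grid by blast
  then obtain \<beta> where \<beta>: "bij_betw \<beta> {..<d} Z"
    using finite_same_card_bij[of "{..<d}" Z] cardZ by auto
  have \<beta>Z: "\<beta> i \<in> Z" if "i < d" for i
    using bij_betwE[OF \<beta>] that by simp
  define p :: "nat \<Rightarrow> nat \<times> nat + ((nat \<times> nat) set \<times> colour) \<times> nat"
    where "p i = (if i < d then Inl (\<beta> i) else Inr ((Z, a), i - d))" for i
  have pV: "p i \<in> pattern_verts" if "i < t" for i
    using that \<beta>Z Zgrid Z by (auto simp: p_def pattern_verts_def)
  have p_inj: "p i = p j \<longleftrightarrow> i = j" for i j
    using bij_betw_imp_inj_on[OF \<beta>] by (auto simp: p_def inj_on_def)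
  have p_adj: "pattern_adj (p i) (p j)" for i j
    using \<beta>Z by (auto simp: p_def)
  have p_edge: "{p i, p j} \<in> pattern_edges \<and> pattern_colour {p i, p j} = a" if ij: "i < j" "j < t" for i j
  proof -
    have "{p i, p j} \<in> pattern_edges"
      using pV p_adj p_inj ij by (auto simp: pattern_edge_iff)
    moreover have "pattern_colour {p i, p j} = a"
    proof (cases "j < d")
      case True
      then have "\<beta> i \<noteq> \<beta> j"
        using bij_betw_imp_inj_on[OF \<beta>] ij by (auto simp: inj_on_def)
      then show ?thesis
        using True ij Zmono \<beta>Z pattern_colour_Inl by (simp add: p_def)
    next
      case False
      then have "p j = Inr ((Z, a), j - d)"
        by (simp add: p_def)
      then show ?thesis
        using pattern_colour_Inr[of Z a "j - d" "p i"] p_adj[of j i] by (simp add: insert_commute)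
    qed
    ultimately show ?thesis
      by blast
  qed
  define m where "m i = (if i < t then \<phi> (p i) else w)" for i
  have "Hcopy E k b m"
  proof (rule HcopyI)
    have "m i \<noteq> m t" if "i < t" for i
      using \<phi>(2) pV[OF that] that by (auto simp: m_def)
    moreover have "i = j" if "i < t" "j < t" "m i = m j" for i j
      using inj_onD[OF \<phi>(1) _ pV pV, of i j] p_inj that by (simp add: m_def)
    ultimately show "inj_on m {..t}"
      unfolding inj_on_def by (metis atMost_iff le_neq_implies_less)
    fix i j assume ij: "hadj i j"
    show "{m i, m j} \<in> E \<and> k {m i, m j} = b"
    proof (cases "j < t")
      case True
      then have "i < j" "i < t"
        using hadj_less[OF ij] by auto
      then show ?thesis
        using E(1)[of "{p i, p j}"] col(1)[of "{p i, p j}"] p_edge[of i j] True by (simp add: m_def)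
    next
      case False
      then have "j = t" "i < d"
        using ij by (auto simp: hadj_def)
      then show ?thesis
        using E(2)[of "\<beta> i"] col(2)[of "\<beta> i"] \<beta>Z[of i] Zgrid t_gt by (auto simp: m_def p_def insert_commute)
    qed
  qed
  then show ?thesis
    by blast
qed

section \<open>Minimal Ramsey subgraphs and the vertex of degree d^2\<close>

lemma subgraph_trans: "subgraph F G \<Longrightarrow> subgraph G H \<Longrightarrow> subgraph F H"
  by (auto simp: subgraph_def)

lemma ramsey_minimal_subgraph:
  assumes F: "simple_graph F" "ramsey_for F H"
  obtains F' where "subgraph F' F" "F' \<in> ramsey_minimal H"
proof -
  define P where "P F' \<longleftrightarrow> subgraph F' F \<and> ramsey_for F' H" for F'
  have "P F"
    using F by (simp add: P_def subgraph_def)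
  then obtain F' where F': "P F'"
    and least: "\<And>F''. P F'' \<Longrightarrow> card (verts F') + card (edges F') \<le> card (verts F'') + card (edges F'')"
    using ex_has_least_nat[of P F "\<lambda>F. card (verts F) + card (edges F)"] by blast
  have "\<not> ramsey_for F'' H" if F'': "subgraph F'' F'" "F'' \<noteq> F'" for F''
  proof
    assume "ramsey_for F'' H"
    then have "P F''"
      using F' F''(1) subgraph_trans by (auto simp: P_def)
    have sF': "simple_graph F'"
      using F' by (simp add: P_def subgraph_def)
    then have "finite (verts F')" "finite (edges F')"
      using finite_imp_finite_nsets[of "verts F'" 2] by (auto simp: simple_graph_def intro: finite_subset)
    moreover have sub: "verts F'' \<subseteq> verts F'" "edges F'' \<subseteq> edges F'"
      using F''(1) by (auto simp: subgraph_def)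
    ultimately have "card (verts F'') \<le> card (verts F')" "card (edges F'') \<le> card (edges F')"
      by (auto intro: card_mono)
    moreover have "verts F'' \<noteq> verts F' \<or> edges F'' \<noteq> edges F'"
      using F''(2) by (cases F'; cases F'') auto
    then have "card (verts F'') < card (verts F') \<or> card (edges F'') < card (edges F')"
      using sub \<open>finite (verts F')\<close> \<open>finite (edges F')\<close> by (metis psubsetI psubset_card_mono)
    ultimately show False
      using least[OF \<open>P F''\<close>] by linarith
  qed
  then have "F' \<in> ramsey_minimal H"
    using F' by (auto simp: ramsey_minimal_def P_def subgraph_def)
  then show thesis
    using that F' by (auto simp: P_def)
qed

lemma min_degree_ramsey_minimal:
  fixes F :: "'a graph"
  assumes F: "F \<in> ramsey_minimal (clique_plus_vertex t d)"
  shows "d\<^sup>2 \<le> min_degree F" "v \<in> verts F \<Longrightarrow> min_degree F \<le> degree F v"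
proof -
  have sF: "simple_graph F" and "ramsey_for F (clique_plus_vertex t d)"
    using F by (auto simp: ramsey_minimal_def)
  then obtain a and c :: "'a set \<Rightarrow> colour" and m where m: "Hcopy (edges F) c a m"
    using ramsey_for_iff by blast
  have "m 0 \<in> verts F"
    using Hcopy_vertex[OF m] sF by (simp add: simple_graph_def)
  moreover have "finite (verts F)"
    using sF by (simp add: simple_graph_def)
  ultimately have fin: "finite (degree F ` verts F)" "degree F ` verts F \<noteq> {}"
    by auto
  then have "Min (degree F ` verts F) \<in> degree F ` verts F"
    by (rule Min_in)
  then show "d\<^sup>2 \<le> min_degree F"
    using degree_ramsey_minimal[OF F] by (auto simp: min_degree_def)
  show "v \<in> verts F \<Longrightarrow> min_degree F \<le> degree F v"
    using fin by (simp add: min_degree_def)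
qed

lemma ramsey_minimal_upper:
  "\<exists>F :: nat graph. F \<in> ramsey_minimal (clique_plus_vertex t d) \<and> min_degree F = d\<^sup>2"
proof -
  obtain V :: "nat set" and E where finV: "finite V" and EV: "E \<subseteq> [V]\<^bsup>2\<^esup>"
    and ex: "\<exists>c. \<forall>a m. \<not> Hcopy E c a m"
    and forced: "\<forall>k. (\<forall>a m. \<not> Hcopy E k a m) \<longrightarrow> (\<exists>\<phi>. inj_on \<phi> pattern_verts \<and> \<phi> ` pattern_verts \<subseteq> V \<and>
      (\<forall>e\<in>pattern_edges. \<phi> ` e \<in> E) \<and> ((\<forall>e\<in>pattern_edges. k (\<phi> ` e) = pattern_colour e) \<or>
        (\<forall>e\<in>pattern_edges. k (\<phi> ` e) = opposite (pattern_colour e))))"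
    using unavoidable[OF finite_pattern_verts pattern_edges_nsets pattern_no_Hcopy]
    by - (erule exE, erule exE, elim conjE, rule that)
  obtain c where noH: "\<And>a m. \<not> Hcopy E c a m"
    using ex by blast
  obtain M where M: "\<And>v. v \<in> V \<Longrightarrow> v < M"
    using finV finite_nat_set_iff_bounded by metis
  define QQ where "QQ = {Q. Q \<subseteq> V \<and> card Q = d\<^sup>2}"
  \<comment> \<open>\<open>set_encode\<close> separates finite sets, and the offset \<open>M\<close>
    moves the new vertices outside \<open>V\<close>.\<close>
  define nv where "nv Q = M + set_encode Q" for Q
  have finQ: "finite Q" if "Q \<in> QQ" for Q
    using that finV finite_subset by (auto simp: QQ_def)
  have finQQ: "finite QQ"
    by (rule finite_subset[of _ "Pow V"]) (use finV in \<open>auto simp: QQ_def\<close>)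
  have nvV: "nv Q \<notin> V" for Q
    using M[of "nv Q"] by (auto simp: nv_def)
  have nv_inj: "nv Q = nv Q' \<longleftrightarrow> Q = Q'" if "Q \<in> QQ" "Q' \<in> QQ" for Q Q'
    using set_encode_eq[OF finQ[OF that(1)] finQ[OF that(2)]] by (simp add: nv_def)
  define F where "F = Graph (V \<union> nv ` QQ) (E \<union> {{nv Q, x} | Q x. Q \<in> QQ \<and> x \<in> Q})"
  have sF: "simple_graph F"
    unfolding simple_graph_def
  proof
    show "finite (verts F)"
      using finV finQQ by (simp add: F_def)
    have "{nv Q, x} \<in> [V \<union> nv ` QQ]\<^bsup>2\<^esup>" if "Q \<in> QQ" "x \<in> Q" for Q x
      using that nvV[of Q] by (auto simp: QQ_def)
    then show "edges F \<subseteq> [verts F]\<^bsup>2\<^esup>"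
      using EV nsets_mono[of V "V \<union> nv ` QQ" 2] by (auto simp: F_def)
  qed
  have "\<exists>a m. Hcopy (edges F) k a m" for k
  proof (rule ccontr)
    assume no: "\<nexists>a m. Hcopy (edges F) k a m"
    have "E \<subseteq> edges F"
      by (simp add: F_def)
    then have "\<forall>a m. \<not> Hcopy E k a m"
      using no Hcopy_mono by blast
    then obtain \<phi> where \<phi>: "inj_on \<phi> pattern_verts" "\<phi> ` pattern_verts \<subseteq> V"
      "\<And>e. e \<in> pattern_edges \<Longrightarrow> \<phi> ` e \<in> E"
      and col: "(\<forall>e\<in>pattern_edges. k (\<phi> ` e) = pattern_colour e) \<or>
        (\<forall>e\<in>pattern_edges. k (\<phi> ` e) = opposite (pattern_colour e))"
      using forced[THEN spec, of k] by blast
    define Q where "Q = (\<lambda>x. \<phi> (Inl x)) ` grid"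
    have gridV: "Inl x \<in> pattern_verts" if "x \<in> grid" for x
      using that by (simp add: pattern_verts_def)
    have "inj_on (\<lambda>x. \<phi> (Inl x)) grid"
      using \<phi>(1) gridV by (auto simp: inj_on_def)
    then have "card Q = d\<^sup>2"
      by (simp add: Q_def card_image grid_def power2_eq_square)
    then have Q: "Q \<in> QQ"
      using \<phi>(2) gridV by (auto simp: QQ_def Q_def)
    have w: "nv Q \<notin> \<phi> ` pattern_verts"
      using nvV \<phi>(2) by blast
    have E1: "\<phi> ` e \<in> edges F" if "e \<in> pattern_edges" for e
      using \<phi>(3)[OF that] by (simp add: F_def)
    have E2: "{nv Q, \<phi> (Inl x)} \<in> edges F" if "x \<in> grid" for x
      using Q that by (auto simp: F_def Q_def)
    from col show False
    proof
      assume col: "\<forall>e\<in>pattern_edges. k (\<phi> ` e) = pattern_colour e"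
      obtain Z a where Z: "(Z, a) \<in> rich" "\<And>x. x \<in> Z \<Longrightarrow> k {nv Q, \<phi> (Inl x)} = a"
        using grid_forcing[of "\<lambda>x. k {nv Q, \<phi> (Inl x)}"] by blast
      have col1: "k (\<phi> ` e) = a" if "e \<in> pattern_edges" "pattern_colour e = a" for e
        using col that by simp
      have "\<exists>m. Hcopy (edges F) k a m"
        using Hcopy_through_pattern[where k = k and b = a, OF \<phi>(1) w E1 E2 Z(1) col1 Z(2)] .
      then show False
        using no by blast
    next
      assume col: "\<forall>e\<in>pattern_edges. k (\<phi> ` e) = opposite (pattern_colour e)"
      \<comment> \<open>For the swapped pattern the grid argument is applied to the swapped colours
        of the new edges.\<close>
      obtain Z a where Z: "(Z, a) \<in> rich" "\<And>x. x \<in> Z \<Longrightarrow> opposite (k {nv Q, \<phi> (Inl x)}) = a"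
        using grid_forcing[of "\<lambda>x. opposite (k {nv Q, \<phi> (Inl x)})"] by blast
      have col2: "k {nv Q, \<phi> (Inl x)} = opposite a" if "x \<in> Z" for x
        using Z(2)[OF that] neq_opposite by (metis opposite_neq(1))
      have col1: "k (\<phi> ` e) = opposite a" if "e \<in> pattern_edges" "pattern_colour e = a" for e
        using col that by simp
      have "\<exists>m. Hcopy (edges F) k (opposite a) m"
        using Hcopy_through_pattern[where k = k and b = "opposite a", OF \<phi>(1) w E1 E2 Z(1) col1 col2] .
      then show False
        using no by blast
    qed
  qed
  then have RF: "ramsey_for F (clique_plus_vertex t d)"
    using ramsey_for_iff[OF sF] by blast
  obtain F' where F': "subgraph F' F" "F' \<in> ramsey_minimal (clique_plus_vertex t d)"
    using ramsey_minimal_subgraph[OF sF RF] by blast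
  have sF': "simple_graph F'" and RF': "ramsey_for F' (clique_plus_vertex t d)"
    using F'(2) by (auto simp: ramsey_minimal_def)
  \<comment> \<open>Otherwise all edges of \<open>F'\<close> lie in \<open>E\<close>, and the H-free
    colouring \<open>c\<close> refutes its Ramsey property.\<close>
  have "\<exists>Q\<in>QQ. nv Q \<in> verts F'"
  proof (rule ccontr)
    assume no: "\<not> ?thesis"
    have "edges F' \<subseteq> E"
    proof
      fix e assume e: "e \<in> edges F'"
      then have "e \<in> E \<or> (\<exists>Q x. Q \<in> QQ \<and> x \<in> Q \<and> e = {nv Q, x})"
        using F'(1) by (auto simp: subgraph_def F_def)
      moreover have "e \<subseteq> verts F'"
        using e sF' by (auto simp: simple_graph_def nsets_def)
      ultimately show "e \<in> E"
        using no by auto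
    qed
    moreover obtain a m where "Hcopy (edges F') c a m"
      using RF' ramsey_for_iff[OF sF'] by blast
    ultimately show False
      using noH Hcopy_mono by blast
  qed
  then obtain Q where Q: "Q \<in> QQ" "nv Q \<in> verts F'"
    by blast
  \<comment> \<open>New vertices are joined only to vertices of \<open>V\<close>, so edges at other
    new vertices do not contain \<open>nv Q\<close>.\<close>
  have "{e \<in> edges F'. nv Q \<in> e} \<subseteq> (\<lambda>x. {nv Q, x}) ` Q"
  proof
    fix e assume e: "e \<in> {e \<in> edges F'. nv Q \<in> e}"
    then have "e \<in> E \<or> (\<exists>Q' x. Q' \<in> QQ \<and> x \<in> Q' \<and> e = {nv Q', x})"
      using F'(1) by (auto simp: subgraph_def F_def)
    moreover have "e \<notin> E"
      using e EV nvV by (auto simp: nsets_def)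
    ultimately obtain Q' x where Q': "Q' \<in> QQ" "x \<in> Q'" "e = {nv Q', x}"
      by blast
    have "nv Q \<noteq> x"
      using Q' nvV[of Q] by (auto simp: QQ_def)
    then have "nv Q = nv Q'"
      using e Q'(3) by auto
    then have "Q' = Q"
      using nv_inj[OF Q(1) Q'(1)] by simp
    then show "e \<in> (\<lambda>x. {nv Q, x}) ` Q"
      using Q' by blast
  qed
  then have "degree F' (nv Q) \<le> card ((\<lambda>x. {nv Q, x}) ` Q)"
    unfolding degree_def using finQ[OF Q(1)] by (intro card_mono) auto
  also have "\<dots> \<le> card Q"
    by (rule card_image_le) (rule finQ[OF Q(1)])
  also have "\<dots> = d\<^sup>2"
    using Q(1) by (simp add: QQ_def)
  finally have "min_degree F' \<le> d\<^sup>2"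
    using min_degree_ramsey_minimal(2)[OF F'(2) Q(2)] by simp
  then have "min_degree F' = d\<^sup>2"
    using min_degree_ramsey_minimal(1)[OF F'(2)] by simp
  then show ?thesis
    using F'(2) by blast
qed

end

theorem theorem3p1:
  fixes t d :: nat
  assumes "1 < d" and "d < t"
  shows "ramsey_min_degree (clique_plus_vertex t d) = d^2"
proof -
  interpret almost_clique t d
    using assms by unfold_locales
  show ?thesis
    unfolding ramsey_min_degree_def
  proof (rule Least_equality)
    show "\<exists>F :: nat graph. F \<in> ramsey_minimal (clique_plus_vertex t d) \<and> min_degree F = d\<^sup>2"
      by (rule ramsey_minimal_upper)
    show "d\<^sup>2 \<le> k" if "\<exists>F :: nat graph. F \<in> ramsey_minimal (clique_plus_vertex t d) \<and> min_degree F = k" for k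
      using that min_degree_ramsey_minimal(1) by blast
  qed
qed

end
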